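(* Let $M=\mathbb S^{2n-1}\times\mathbb S^1$ with $n\ge2$ be the standard Hopf manifold and $\omega_0$ its canonical metric. Then the perturbed Hermitian metric $$\omega=\omega_0-\frac4n\,\mathfrak R^{(1)}(\omega_0)$$ is Levi-Civita Ricci-flat, i.e. $\mathfrak R^{(1)}(\omega)=0$.
   Context: The Hopf manifold $M=\mathbb S^{2n-1}\times\mathbb S^1$ carries the complex structure of $(\mathbb C^n\setminus\{0\})/G$, where $G$ is the cyclic group generated by $z\mapsto\frac12z$. Its canonical Hermitian metric is $\omega_0=\sqrt{-1}\,\frac{4\delta_{ij}}{|z|^2}dz^i\wedge d\bar z^j$. For a Hermitian metric $\omega=\sqrt{-1}\,h_{i\bar j}dz^i\wedge d\bar z^j$ on a complex manifold, with associated $J$-invariant Riemannian metric $g$ (extended $\mathbb C$-bilinearly, $h_{i\bar j}=g(\partial/\partial z^i,\partial/\partial\bar z^j)$, $h^{i\bar\ell}h_{k\bar\ell}=\delta^i_k$), let $\nabla$ be the Levi-Civita connection of $g$ extended $\mathbb C$-linearly, $\pi:T_{\mathbb C}M\to T^{1,0}M$ the projection, $\hat\nabla=\pi\circ\nabla$ the induced connection on $T^{1,0}M$, and $\mathfrak R(X,Y)s=\hat\nabla_X\hat\nabla_Ys-\hat\nabla_Y\hat\nabla_Xs-\hat\nabla_{[X,Y]}s$ its curvature. Write $\mathfrak R(\partial/\partial z^i,\partial/\partial\bar z^j)\,\partial/\partial z^k=\mathfrak R_{i\bar jk}^{\ell}\,\partial/\partial z^\ell$ and $\mathfrak R_{i\bar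 jk\bar\ell}=\mathfrak R_{i\bar jk}^sh_{s\bar\ell}$. The first Levi-Civita Ricci form is $\mathfrak R^{(1)}(\omega)=\sqrt{-1}\,h^{k\bar\ell}\mathfrak R_{i\bar jk\bar\ell}\,dz^i\wedge d\bar z^j$. (Summation convention.) *)

theory Defs
  imports "HOL-Analysis.Analysis"
begin

section \<open>Smooth maps on open subsets of a Euclidean space\<close>

fun ck_on :: "nat \<Rightarrow> 'a::euclidean_space set \<Rightarrow> ('a \<Rightarrow> 'b::real_normed_vector) \<Rightarrow> bool" where
  "ck_on 0 U f \<longleftrightarrow> continuous_on U f"
| "ck_on (Suc k) U f \<longleftrightarrow>
     f differentiable_on U \<and> (\<forall>v. ck_on k U (\<lambda>x. frechet_derivative f (at x) v))"

text \<open>Only used for open \<open>U\<close>, where \<open>at x within U\<close> and \<open>at x\<close> agree.\<close>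

definition smooth_on :: "'a::euclidean_space set \<Rightarrow> ('a \<Rightarrow> 'b::real_normed_vector) \<Rightarrow> bool" where
  "smooth_on U f \<longleftrightarrow> (\<forall>k. ck_on k U f)"


section \<open>Complex manifolds and Hermitian metrics in terms of charts\<close>

type_synonym ('m, 'n) chart = "'m set \<times> ('m \<Rightarrow> complex ^ 'n)"

definition chart_image :: "('m, 'n) chart \<Rightarrow> (complex ^ 'n) set" where
  "chart_image c = snd c ` fst c"

definition transition :: "('m, 'n) chart \<Rightarrow> ('m, 'n) chart \<Rightarrow> complex ^ 'n \<Rightarrow> complex ^ 'n" where
  "transition c c' z = snd c' (inv_into (fst c) (snd c) z)"

definition complex_atlas ::
  "'m::topological_space set \<Rightarrow> ('m, 'n::finite) chart set \<Rightarrow> bool" where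
  "complex_atlas M A \<longleftrightarrow>
     (\<forall>c\<in>A. openin (top_of_set M) (fst c) \<and> open (chart_image c) \<and>
        (\<exists>inv. homeomorphism (fst c) (chart_image c) (snd c) inv)) \<and>
     (\<Union>c\<in>A. fst c) = M \<and>
     (\<forall>c\<in>A. \<forall>c'\<in>A. \<forall>z \<in> snd c ` (fst c \<inter> fst c').
        transition c c' differentiable (at z) \<and>
        (\<forall>a v. frechet_derivative (transition c c') (at z) (a *s v) =
               a *s frechet_derivative (transition c c') (at z) v))"

text \<open>
  A form \<open>\<surd>-1 \<alpha>\<^sub>i\<^sub>j dz\<^sup>i \<and> d\<bar>z\<^sup>j\<close> is represented by the family of its coefficient matrices:
  one matrix-valued function on \<open>chart_image c\<close> for every chart \<open>c\<close> of the atlas. Since the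
  transition maps are holomorphic, the matrix of their real derivative on the standard basis
  vectors \<open>axis i 1\<close> is the complex Jacobian \<open>\<partial>w\<^sup>k/\<partial>z\<^sup>i\<close> (row \<open>k\<close>, column \<open>i\<close>).
\<close>

type_synonym ('m, 'n) form11 = "('m, 'n) chart \<Rightarrow> complex ^ 'n \<Rightarrow> complex ^ 'n ^ 'n"

definition form11_on :: "('m, 'n::finite) chart set \<Rightarrow> ('m, 'n) form11 \<Rightarrow> bool" where
  "form11_on A \<alpha> \<longleftrightarrow>
     (\<forall>c\<in>A. smooth_on (chart_image c) (\<alpha> c)) \<and>
     (\<forall>c\<in>A. \<forall>c'\<in>A. \<forall>z \<in> snd c ` (fst c \<inter> fst c').
        let T = transition c c'; Jac = matrix (frechet_derivative T (at z))
        in \<forall>i j. \<alpha> c z $ i $ j =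
             (\<Sum>k\<in>UNIV. \<Sum>l\<in>UNIV. Jac $ k $ i * cnj (Jac $ l $ j) * \<alpha> c' (T z) $ k $ l))"

definition hermitian_metric_on :: "('m, 'n::finite) chart set \<Rightarrow> ('m, 'n) form11 \<Rightarrow> bool" where
  "hermitian_metric_on A h \<longleftrightarrow> form11_on A h \<and>
     (\<forall>c\<in>A. \<forall>z\<in>chart_image c.
        (\<forall>i j. h c z $ j $ i = cnj (h c z $ i $ j)) \<and>
        (\<forall>v. v \<noteq> 0 \<longrightarrow> 0 < Re (\<Sum>i\<in>UNIV. \<Sum>j\<in>UNIV. h c z $ i $ j * v $ i * cnj (v $ j))))"


section \<open>The Levi-Civita connection on a coordinate domain\<close>

text \<open>
  Real vector fields on an open subset \<open>U\<close> of a Euclidean space \<open>'a\<close> are functions \<open>'a \<Rightarrow> 'a\<close>;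
  their values outside \<open>U\<close> are irrelevant. \<open>D X Y\<close> stands for \<open>\<nabla>\<^sub>X Y\<close>.
\<close>

definition lie_derivative ::
  "('a::euclidean_space \<Rightarrow> 'a) \<Rightarrow> ('a \<Rightarrow> 'b::real_normed_vector) \<Rightarrow> 'a \<Rightarrow> 'b" where
  "lie_derivative X f x = frechet_derivative f (at x) (X x)"

definition lie_bracket :: "('a::euclidean_space \<Rightarrow> 'a) \<Rightarrow> ('a \<Rightarrow> 'a) \<Rightarrow> 'a \<Rightarrow> 'a" where
  "lie_bracket X Y x = lie_derivative X Y x - lie_derivative Y X x"

definition affine_connection ::
  "'a::euclidean_space set \<Rightarrow> (('a \<Rightarrow> 'a) \<Rightarrow> ('a \<Rightarrow> 'a) \<Rightarrow> 'a \<Rightarrow> 'a) \<Rightarrow> bool" where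
  "affine_connection U D \<longleftrightarrow>
     (\<forall>X Y. smooth_on U X \<and> smooth_on U Y \<longrightarrow> smooth_on U (D X Y)) \<and>
     (\<forall>X X' Y. smooth_on U X \<and> smooth_on U X' \<and> smooth_on U Y \<longrightarrow>
        (\<forall>x\<in>U. D (\<lambda>y. X y + X' y) Y x = D X Y x + D X' Y x)) \<and>
     (\<forall>f X Y. smooth_on U f \<and> smooth_on U X \<and> smooth_on U Y \<longrightarrow>
        (\<forall>x\<in>U. D (\<lambda>y. f y *\<^sub>R X y) Y x = f x *\<^sub>R D X Y x)) \<and>
     (\<forall>X Y Y'. smooth_on U X \<and> smooth_on U Y \<and> smooth_on U Y' \<longrightarrow>
        (\<forall>x\<in>U. D X (\<lambda>y. Y y + Y' y) x = D X Y x + D X Y' x)) \<and>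
     (\<forall>f X Y. smooth_on U f \<and> smooth_on U X \<and> smooth_on U Y \<longrightarrow>
        (\<forall>x\<in>U. D X (\<lambda>y. f y *\<^sub>R Y y) x =
           lie_derivative X f x *\<^sub>R Y x + f x *\<^sub>R D X Y x))"

definition is_levi_civita ::
  "'a::euclidean_space set \<Rightarrow> ('a \<Rightarrow> 'a \<Rightarrow> 'a \<Rightarrow> real) \<Rightarrow>
   (('a \<Rightarrow> 'a) \<Rightarrow> ('a \<Rightarrow> 'a) \<Rightarrow> 'a \<Rightarrow> 'a) \<Rightarrow> bool" where
  "is_levi_civita U g D \<longleftrightarrow> affine_connection U D \<and>
     (\<forall>X Y. smooth_on U X \<and> smooth_on U Y \<longrightarrow>
        (\<forall>x\<in>U. D X Y x - D Y X x = lie_bracket X Y x)) \<and>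
     (\<forall>X Y Z. smooth_on U X \<and> smooth_on U Y \<and> smooth_on U Z \<longrightarrow>
        (\<forall>x\<in>U. lie_derivative Z (\<lambda>y. g y (X y) (Y y)) x =
           g x (D Z X x) (Y x) + g x (X x) (D Z Y x)))"

text \<open>
  By the fundamental theorem of Riemannian geometry such a connection exists for every
  Riemannian metric \<open>g\<close> on the open set \<open>U\<close>, and its values on \<open>U\<close> for smooth fields are
  unique; the choice only affects irrelevant values.
\<close>

definition levi_civita ::
  "'a::euclidean_space set \<Rightarrow> ('a \<Rightarrow> 'a \<Rightarrow> 'a \<Rightarrow> real) \<Rightarrow>
   ('a \<Rightarrow> 'a) \<Rightarrow> ('a \<Rightarrow> 'a) \<Rightarrow> 'a \<Rightarrow> 'a" where
  "levi_civita U g = (SOME D. is_levi_civita U g D)"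


section \<open>The complexified tangent bundle\<close>

text \<open>
  A real tangent vector at a point of \<open>\<complex>\<^sup>n\<close> is an element of \<open>\<complex>\<^sup>n\<close>, and \<open>cplx_J\<close> is multiplication
  by \<open>\<i>\<close>. A pair \<open>(A, B)\<close> stands for the element \<open>A + \<surd>-1 B\<close> of the complexification; this
  \<open>\<surd>-1\<close> is not the multiplication by \<open>\<i>\<close> on \<open>\<complex>\<^sup>n\<close>.
\<close>

type_synonym 'n cvec = "(complex ^ 'n) \<times> (complex ^ 'n)"
type_synonym 'n cfield = "complex ^ 'n \<Rightarrow> 'n cvec"
type_synonym 'n conn =
  "(complex ^ 'n \<Rightarrow> complex ^ 'n) \<Rightarrow> (complex ^ 'n \<Rightarrow> complex ^ 'n) \<Rightarrow> complex ^ 'n \<Rightarrow> complex ^ 'n"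

definition cplx_J :: "complex ^ 'n \<Rightarrow> complex ^ 'n" where
  "cplx_J v = \<i> *s v"

text \<open>\<open>\<partial>/\<partial>z\<^sup>i = (\<partial>/\<partial>x\<^sup>i - \<surd>-1 \<partial>/\<partial>y\<^sup>i)/2\<close>, its conjugate, and the \<open>\<complex>\<close>-linear form \<open>dz\<^sup>i\<close>.\<close>

definition d_z :: "'n::finite \<Rightarrow> 'n cvec" where
  "d_z i = (1/2) *\<^sub>R (axis i 1, - cplx_J (axis i 1))"

definition d_zbar :: "'n::finite \<Rightarrow> 'n cvec" where
  "d_zbar i = (1/2) *\<^sub>R (axis i 1, cplx_J (axis i 1))"

definition dz :: "'n::finite \<Rightarrow> 'n cvec \<Rightarrow> complex" where
  "dz i W = fst W $ i + \<i> * snd W $ i"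

text \<open>The projection \<open>W \<mapsto> (W - \<surd>-1 J W)/2\<close> onto \<open>T\<^sup>1\<^sup>,\<^sup>0\<close>, the \<open>\<surd>-1\<close>-eigenspace of \<open>J\<close>.\<close>

definition proj10 :: "'n::finite cvec \<Rightarrow> 'n cvec" where
  "proj10 W = (1/2) *\<^sub>R (fst W + cplx_J (snd W), snd W - cplx_J (fst W))"

text \<open>The \<open>\<complex>\<close>-bilinear extension of a real bilinear operation on vector fields.\<close>

definition complexify_op :: "'n::finite conn \<Rightarrow> 'n cfield \<Rightarrow> 'n cfield \<Rightarrow> 'n cfield" where
  "complexify_op D X Y x =
     (D (fst \<circ> X) (fst \<circ> Y) x - D (snd \<circ> X) (snd \<circ> Y) x,
      D (fst \<circ> X) (snd \<circ> Y) x + D (snd \<circ> X) (fst \<circ> Y) x)"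


section \<open>The first Levi-Civita Ricci form\<close>

text \<open>
  The \<open>J\<close>-invariant Riemannian metric of \<open>\<surd>-1 h\<^sub>i\<^sub>j dz\<^sup>i \<and> d\<bar>z\<^sup>j\<close>: the real vector \<open>u\<close> is
  \<open>u\<^sup>i \<partial>/\<partial>z\<^sup>i + cnj u\<^sup>i \<partial>/\<partial>\<bar>z\<^sup>i\<close>, whence the factor 2 under the normalization
  \<open>h\<^sub>i\<^sub>j = g(\<partial>/\<partial>z\<^sup>i, \<partial>/\<partial>\<bar>z\<^sup>j)\<close>, see \<open>riemannian_metric_d_z\<close> below.
\<close>

definition riemannian_metric ::
  "(complex ^ 'n \<Rightarrow> complex ^ 'n ^ 'n) \<Rightarrow>
   complex ^ 'n::finite \<Rightarrow> complex ^ 'n \<Rightarrow> complex ^ 'n \<Rightarrow> real" where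
  "riemannian_metric h x u v = 2 * Re (\<Sum>i\<in>UNIV. \<Sum>j\<in>UNIV. h x $ i $ j * u $ i * cnj (v $ j))"

definition complexify_bilinear ::
  "(complex ^ 'n \<Rightarrow> complex ^ 'n \<Rightarrow> real) \<Rightarrow> 'n::finite cvec \<Rightarrow> 'n cvec \<Rightarrow> complex" where
  "complexify_bilinear b V W =
     Complex (b (fst V) (fst W) - b (snd V) (snd W)) (b (fst V) (snd W) + b (snd V) (fst W))"

lemma riemannian_metric_d_z:
  fixes h :: "complex ^ 'n \<Rightarrow> complex ^ 'n ^ 'n::finite"
  assumes herm: "\<And>i j. h x $ j $ i = cnj (h x $ i $ j)"
  shows "complexify_bilinear (riemannian_metric h x) (d_z i) (d_zbar j) = h x $ i $ j"
    and "complexify_bilinear (riemannian_metric h x) (d_z i) (d_z j) = 0"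
    and "riemannian_metric h x (cplx_J u) (cplx_J v) = riemannian_metric h x u v"
    and "riemannian_metric h x u v = riemannian_metric h x v u"
proof -
  have b: "riemannian_metric h x (a *s axis i 1) (b *s axis j 1) = 2 * Re (h x $ i $ j * a * cnj b)"
    for a b i j
  proof -
    have "h x $ i' $ j' * (a *s axis i 1) $ i' * cnj ((b *s axis j 1) $ j') =
        (if i' = i then if j' = j then h x $ i $ j * a * cnj b else 0 else 0)" for i' j'
      by (simp add: axis_def)
    moreover have "(\<Sum>j'\<in>UNIV. if i' = i then if j' = j then h x $ i $ j * a * cnj b else 0 else 0)
        = (if i' = i then h x $ i $ j * a * cnj b else 0)" for i'
      by simp
    ultimately show ?thesis
      by (simp add: riemannian_metric_def del: vector_smult_component complex_cnj_mult)
  qed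
  have e: "(1/2) *\<^sub>R axis i (1::complex) = (1/2) *s axis i 1"
          "(1/2) *\<^sub>R cplx_J (axis i 1) = (\<i>/2) *s axis i 1"
          "(1/2) *\<^sub>R (- cplx_J (axis i 1)) = (- \<i>/2) *s axis i 1" for i :: 'n
    by (simp_all add: vec_eq_iff cplx_J_def scaleR_conv_of_real[where 'a = complex])
  show "complexify_bilinear (riemannian_metric h x) (d_z i) (d_zbar j) = h x $ i $ j"
    and "complexify_bilinear (riemannian_metric h x) (d_z i) (d_z j) = 0"
    unfolding d_z_def d_zbar_def complexify_bilinear_def scaleR_Pair fst_conv snd_conv e b
    by (simp_all add: complex_eq_iff)
  show "riemannian_metric h x (cplx_J u) (cplx_J v) = riemannian_metric h x u v"
  proof -
    have "h x $ i $ j * (\<i> * u $ i) * cnj (\<i> * v $ j) = h x $ i $ j * u $ i * cnj (v $ j)" for i j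
      by (simp add: algebra_simps)
    then show ?thesis
      by (simp only: riemannian_metric_def cplx_J_def vector_smult_component)
  qed
  show "riemannian_metric h x u v = riemannian_metric h x v u"
  proof -
    have "(\<Sum>i\<in>UNIV. \<Sum>j\<in>UNIV. h x $ i $ j * v $ i * cnj (u $ j))
        = (\<Sum>j\<in>UNIV. \<Sum>i\<in>UNIV. h x $ i $ j * v $ i * cnj (u $ j))"
      by (rule sum.swap)
    also have "\<dots> = cnj (\<Sum>i\<in>UNIV. \<Sum>j\<in>UNIV. h x $ i $ j * u $ i * cnj (v $ j))"
      by (simp add: herm[symmetric] algebra_simps)
    finally show ?thesis
      by (simp only: riemannian_metric_def cnj.simps)
  qed
qed

definition induced_connection :: "'n::finite conn \<Rightarrow> 'n cfield \<Rightarrow> 'n cfield \<Rightarrow> 'n cfield" where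
  "induced_connection D X s x = proj10 (complexify_op D X s x)"

definition induced_curvature ::
  "'n::finite conn \<Rightarrow> 'n cfield \<Rightarrow> 'n cfield \<Rightarrow> 'n cfield \<Rightarrow> 'n cfield" where
  "induced_curvature D X Y s x =
     induced_connection D X (induced_connection D Y s) x
     - induced_connection D Y (induced_connection D X s) x
     - induced_connection D (complexify_op lie_bracket X Y) s x"

text \<open>\<open>\<RR>\<^sub>i\<^sub>j\<^sub>k\<^sup>l\<close> and \<open>\<RR>\<^sub>i\<^sub>j\<^sub>k\<^sub>l\<close>; the second and, in the latter, the fourth index are barred.\<close>

definition lc_curvature_up ::
  "(complex ^ 'n) set \<Rightarrow> (complex ^ 'n \<Rightarrow> complex ^ 'n ^ 'n) \<Rightarrow>
   complex ^ 'n \<Rightarrow> 'n \<Rightarrow> 'n \<Rightarrow> 'n \<Rightarrow> 'n::finite \<Rightarrow> complex" where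
  "lc_curvature_up U h x i j k l =
     dz l (induced_curvature (levi_civita U (riemannian_metric h))
             (\<lambda>_. d_z i) (\<lambda>_. d_zbar j) (\<lambda>_. d_z k) x)"

definition lc_curvature ::
  "(complex ^ 'n) set \<Rightarrow> (complex ^ 'n \<Rightarrow> complex ^ 'n ^ 'n) \<Rightarrow>
   complex ^ 'n \<Rightarrow> 'n \<Rightarrow> 'n \<Rightarrow> 'n \<Rightarrow> 'n::finite \<Rightarrow> complex" where
  "lc_curvature U h x i j k l = (\<Sum>s\<in>UNIV. lc_curvature_up U h x i j k s * h x $ s $ l)"

text \<open>The convention \<open>h\<^sup>i\<^sup>l h\<^sub>k\<^sub>l = \<delta>\<^sup>i\<^sub>k\<close> makes \<open>h\<^sup>i\<^sup>l\<close> the transpose of the matrix inverse.\<close>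

definition h_up :: "complex ^ 'n ^ 'n::finite \<Rightarrow> 'n \<Rightarrow> 'n \<Rightarrow> complex" where
  "h_up H i l = matrix_inv H $ l $ i"

definition first_lc_ricci_form :: "('m, 'n::finite) form11 \<Rightarrow> ('m, 'n) form11" where
  "first_lc_ricci_form h c x =
     (\<chi> i j. \<Sum>k\<in>UNIV. \<Sum>l\<in>UNIV. h_up (h c x) k l * lc_curvature (chart_image c) (h c) x i j k l)"


section \<open>The Hopf manifold\<close>

text \<open>
  The underlying space is \<open>S\<^sup>2\<^sup>n\<^sup>-\<^sup>1 \<times> S\<^sup>1\<close>. Its complex structure is that of the quotient of
  \<open>\<complex>\<^sup>n - {0}\<close> by the group generated by \<open>z \<mapsto> z/2\<close>: the map \<open>hopf_proj\<close> below is onto, its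
  fibres are the orbits, and the charts are its continuous local sections.
\<close>

definition hopf_manifold :: "((complex ^ 'n::finite) \<times> complex) set" where
  "hopf_manifold = sphere 0 1 \<times> sphere 0 1"

definition hopf_proj :: "complex ^ 'n::finite \<Rightarrow> (complex ^ 'n) \<times> complex" where
  "hopf_proj z = (z /\<^sub>R norm z, cis (2 * pi * log 2 (norm z)))"

definition hopf_atlas :: "((complex ^ 'n::finite) \<times> complex, 'n) chart set" where
  "hopf_atlas = {c. openin (top_of_set hopf_manifold) (fst c) \<and>
     open (chart_image c) \<and> 0 \<notin> chart_image c \<and> continuous_on (fst c) (snd c) \<and>
     (\<forall>p\<in>fst c. hopf_proj (snd c p) = p)}"

text \<open>\<open>\<omega>\<^sub>0\<close> is given by the same formula in all these charts, being invariant under \<open>z \<mapsto> z/2\<close>.\<close>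

definition hopf_metric :: "((complex ^ 'n::finite) \<times> complex, 'n) form11" where
  "hopf_metric c z = (\<chi> i j. if i = j then of_real (4 / (norm z)\<^sup>2) else 0)"

lemma hopf_proj_surj: "hopf_proj ` (- {0}) = (hopf_manifold :: ((complex ^ 'n::finite) \<times> complex) set)"
proof (intro equalityI subsetI)
  fix p assume "p \<in> (hopf_proj ` (- {0}) :: ((complex ^ 'n) \<times> complex) set)"
  then show "p \<in> hopf_manifold"
    by (auto simp: hopf_proj_def hopf_manifold_def)
next
  fix p :: "(complex ^ 'n) \<times> complex" assume "p \<in> hopf_manifold"
  then obtain s t where p: "p = (s, t)" "norm s = 1" "norm t = 1"
    by (auto simp: hopf_manifold_def)
  define z where "z = (2 powr (Arg t / (2 * pi))) *\<^sub>R s"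
  have "norm z = 2 powr (Arg t / (2 * pi))" "z \<noteq> 0"
    using p by (auto simp: z_def)
  moreover have "cis (Arg t) = t"
    using p by (metis cis_Arg norm_zero sgn_eq div_by_1 of_real_1 zero_neq_one)
  ultimately have "hopf_proj z = p"
    by (simp add: hopf_proj_def p z_def)
  then show "p \<in> hopf_proj ` (- {0})"
    using \<open>z \<noteq> 0\<close> by blast
qed

lemma cis_eq_iff_2pi: "cis a = cis b \<longleftrightarrow> (\<exists>m::int. a = b + 2 * pi * m)"
  using sin_cos_eq_iff[of a b] by (auto simp: complex_eq_iff)

lemma hopf_proj_eq_iff:
  fixes z w :: "complex ^ 'n::finite"
  assumes "z \<noteq> 0" "w \<noteq> 0"
  shows "hopf_proj z = hopf_proj w \<longleftrightarrow> (\<exists>k::int. w = (1/2) powi k *\<^sub>R z)"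
proof
  assume "hopf_proj z = hopf_proj w"
  then have dir: "z /\<^sub>R norm z = w /\<^sub>R norm w"
    and "cis (2 * pi * log 2 (norm z)) = cis (2 * pi * log 2 (norm w))"
    by (auto simp: hopf_proj_def)
  then obtain m :: int where "2 * pi * log 2 (norm z) = 2 * pi * log 2 (norm w) + 2 * pi * m"
    unfolding cis_eq_iff_2pi by blast
  then have "2 * pi * (log 2 (norm z)) = 2 * pi * (log 2 (norm w) + m)"
    by (simp add: algebra_simps)
  then have m: "log 2 (norm w) = log 2 (norm z) + - of_int m"
    by simp
  have "norm w = 2 powr (log 2 (norm z) + - of_int m)"
    using assms by (metis m powr_log_cancel zero_less_norm_iff zero_less_numeral one_eq_numeral_iff semiring_norm(85))
  also have "\<dots> = norm z * (1/2) powi m"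
    using assms by (simp add: powr_diff powr_real_of_int' power_int_divide_distrib)
  finally have "norm w = norm z * (1/2) powi m" .
  moreover have "w = norm w *\<^sub>R (z /\<^sub>R norm z)"
    using assms by (simp add: dir)
  ultimately have "w = (1/2) powi m *\<^sub>R z"
    using assms by simp
  then show "\<exists>k::int. w = (1/2) powi k *\<^sub>R z" ..
next
  assume "\<exists>k::int. w = (1/2) powi k *\<^sub>R z"
  then obtain k :: int where k: "w = (1/2) powi k *\<^sub>R z" ..
  have pos: "(1/2::real) powi k > 0"
    by simp
  have "log 2 ((1/2) powi k) = - of_int k"
  proof -
    have "(1/2::real) powi k = 2 powr (- of_int k)"
      by (simp add: powr_minus powr_real_of_int' power_int_divide_distrib inverse_eq_divide)
    then show ?thesis by simp
  qed
  then have "log 2 (norm w) = log 2 (norm z) - of_int k"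
    using assms pos by (simp add: k log_mult)
  then have "2 * pi * log 2 (norm z) = 2 * pi * log 2 (norm w) + 2 * pi * k"
    by (simp only: distrib_left flip: eq_diff_eq) (simp add: right_diff_distrib)
  then have "cis (2 * pi * log 2 (norm z)) = cis (2 * pi * log 2 (norm w))"
    unfolding cis_eq_iff_2pi by blast
  moreover have "z /\<^sub>R norm z = w /\<^sub>R norm w"
    using pos by (simp add: k)
  ultimately show "hopf_proj z = hopf_proj w"
    by (simp add: hopf_proj_def)
qed

lemma complex_atlas_hopf:
  "complex_atlas hopf_manifold (hopf_atlas :: ((complex ^ 'n::finite) \<times> complex, 'n) chart set)"
proof -
  have inM: "hopf_proj z \<in> hopf_manifold" if "z \<noteq> 0" for z :: "complex ^ 'n"
    using hopf_proj_surj that by blast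
  have cont: "continuous_on (- {0}) (hopf_proj :: complex ^ 'n \<Rightarrow> _)"
    unfolding hopf_proj_def by (auto intro!: continuous_intros)
  have homeo: "homeomorphism (fst c) (chart_image c) (snd c) hopf_proj"
    if "c \<in> hopf_atlas" for c :: "((complex ^ 'n) \<times> complex, 'n) chart"
    unfolding homeomorphism_def
  proof (intro conjI)
    have pr: "hopf_proj (snd c p) = p" if "p \<in> fst c" for p
      using that \<open>c \<in> hopf_atlas\<close> by (simp add: hopf_atlas_def)
    then show "\<forall>p\<in>fst c. hopf_proj (snd c p) = p" "hopf_proj ` chart_image c = fst c"
        "\<forall>y\<in>chart_image c. snd c (hopf_proj y) = y"
      by (auto simp: chart_image_def image_image)
    show "continuous_on (fst c) (snd c)" "snd c ` fst c = chart_image c"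
      using that by (auto simp: hopf_atlas_def chart_image_def)
    show "continuous_on (chart_image c) hopf_proj"
      using that by (intro continuous_on_subset[OF cont]) (auto simp: hopf_atlas_def)
  qed
  have cover: "\<exists>c\<in>hopf_atlas. p \<in> fst c"
    if p: "p \<in> hopf_manifold" for p :: "(complex ^ 'n) \<times> complex"
  proof -
    obtain z0 :: "complex ^ 'n" where z0: "z0 \<noteq> 0" "hopf_proj z0 = p"
      using p hopf_proj_surj by (metis ComplD imageE insertI1)
    define r where "r = norm z0"
    define t0 where "t0 = cis (2 * pi * log 2 r)"
    have r: "r > 0" using z0 by (simp add: r_def)
    have t0: "t0 = snd p" "t0 \<noteq> 0" "norm t0 = 1"
      using z0 by (auto simp: t0_def r_def hopf_proj_def)
    define \<theta> where "\<theta> = (\<lambda>q :: (complex ^ 'n) \<times> complex. Arg (snd q / t0))"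
    define V where "V = {q \<in> hopf_manifold. snd q / t0 \<notin> \<real>\<^sub>\<le>\<^sub>0} \<inter> (UNIV :: ((complex ^ 'n) \<times> complex) set)"
    define \<phi> where "\<phi> = (\<lambda>q. (r * 2 powr (\<theta> q / (2 * pi))) *\<^sub>R fst q)"
    have "open {q :: (complex ^ 'n) \<times> complex. snd q / t0 \<in> - \<real>\<^sub>\<le>\<^sub>0}"
      using t0 by (intro open_vimage[unfolded vimage_def] continuous_intros)
        (auto simp: closed_nonpos_Reals_complex open_Compl)
    then have "openin (top_of_set hopf_manifold) V"
      unfolding V_def by (auto simp: openin_open Int_def)
    moreover have "continuous_on V \<phi>"
    proof -
      have "continuous_on V \<theta>"
        unfolding \<theta>_def
        by (rule continuous_on_compose2[where g = Arg and t = "- \<real>\<^sub>\<le>\<^sub>0"])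
          (use t0 in \<open>auto simp: V_def intro!: continuous_intros continuous_at_imp_continuous_on continuous_at_Arg\<close>)
      then show ?thesis
        unfolding \<phi>_def by (auto intro!: continuous_intros)
    qed
    moreover have proj: "hopf_proj (\<phi> q) = q" if q: "q \<in> V" for q
    proof -
      have n: "norm (fst q) = 1" "norm (snd q) = 1"
        using q by (auto simp: V_def hopf_manifold_def)
      then have nrm: "norm (\<phi> q) = r * 2 powr (\<theta> q / (2 * pi))"
        using r by (simp add: \<phi>_def)
      have "cis (\<theta> q) = snd q / t0"
      proof -
        have "norm (snd q / t0) = 1"
          using n t0 by (simp add: norm_divide)
        moreover from this have "snd q / t0 \<noteq> 0"
          by (metis norm_zero zero_neq_one)
        ultimately show ?thesis
          unfolding \<theta>_def by (subst cis_Arg) (simp_all only: sgn_eq of_real_1 div_by_1 not_False_eq_True)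
      qed
      moreover have "2 * pi * log 2 (norm (\<phi> q)) = 2 * pi * log 2 r + \<theta> q"
        using r by (simp add: nrm log_mult algebra_simps)
      ultimately have "cis (2 * pi * log 2 (norm (\<phi> q))) = snd q"
        using t0 by (simp add: t0_def flip: cis_mult)
      moreover have "\<phi> q /\<^sub>R norm (\<phi> q) = fst q"
        using r unfolding nrm by (simp add: \<phi>_def field_simps)
      ultimately show ?thesis
        by (simp add: hopf_proj_def)
    qed
    moreover have "\<phi> ` V = {z. r * 2 powr (- 1/2) < norm z \<and> norm z < r * 2 powr (1/2)}"
    proof (intro equalityI subsetI)
      fix z assume "z \<in> \<phi> ` V"
      then obtain q where q: "q \<in> V" "z = \<phi> q" by blast
      then have "snd q / t0 \<notin> \<real>\<^sub>\<le>\<^sub>0" "norm (fst q) = 1"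
        by (auto simp: V_def hopf_manifold_def)
      then have "- pi < \<theta> q" "\<theta> q < pi"
        using Arg_bounded[of "snd q / t0"] Arg_eq_pi_iff[of "snd q / t0"]
        by (auto simp: \<theta>_def complex_nonpos_Reals_iff less_le Arg_eq_pi complex_is_Real_iff)
      then have "- 1/2 < \<theta> q / (2 * pi)" "\<theta> q / (2 * pi) < 1/2"
        by (auto simp: field_simps)
      with \<open>norm (fst q) = 1\<close> r show "z \<in> {z. r * 2 powr (- 1/2) < norm z \<and> norm z < r * 2 powr (1/2)}"
        by (simp add: q \<phi>_def)
    next
      fix z :: "complex ^ 'n"
      assume "z \<in> {z. r * 2 powr (- 1/2) < norm z \<and> norm z < r * 2 powr (1/2)}"
      then have z: "r * 2 powr (- 1/2) < norm z" "norm z < r * 2 powr (1/2)" by auto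
      then have nz: "norm z > 0"
        using r by (smt (verit) mult_pos_pos powr_gt_zero)
      define \<alpha> where "\<alpha> = 2 * pi * (log 2 (norm z) - log 2 r)"
      have "log 2 (r * 2 powr (- 1/2)) < log 2 (norm z)" "log 2 (norm z) < log 2 (r * 2 powr (1/2))"
        using z r nz by (auto simp: log_less_cancel_iff)
      then have "- 1/2 < log 2 (norm z) - log 2 r" "log 2 (norm z) - log 2 r < 1/2"
        using r by (auto simp: log_mult)
      then have \<alpha>: "- pi < \<alpha>" "\<alpha> < pi"
        unfolding \<alpha>_def
        using mult_strict_left_mono[of "- 1/2" "log 2 (norm z) - log 2 r" "2 * pi"]
          mult_strict_left_mono[of "log 2 (norm z) - log 2 r" "1/2" "2 * pi"]
        by auto
      have cis: "snd (hopf_proj z) / t0 = cis \<alpha>"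
        by (simp add: hopf_proj_def t0_def \<alpha>_def cis_divide algebra_simps)
      have th: "\<theta> (hopf_proj z) = \<alpha>"
        unfolding \<theta>_def cis using \<alpha> by (intro cis_Arg_unique) (auto simp: sgn_eq)
      have "cis \<alpha> \<notin> \<real>\<^sub>\<le>\<^sub>0"
      proof
        assume "cis \<alpha> \<in> \<real>\<^sub>\<le>\<^sub>0"
        then have "Re (cis \<alpha>) \<le> 0" "Im (cis \<alpha>) = 0"
          by (simp_all only: complex_nonpos_Reals_iff)
        moreover from this have "Re (cis \<alpha>) \<noteq> 0"
          using cis_neq_zero[of \<alpha>] by (metis complex_eq_iff zero_complex.sel)
        ultimately have "Arg (cis \<alpha>) = pi"
          by (simp only: Arg_eq_pi less_le simp_thms)
        then show False
          using th \<alpha> unfolding \<theta>_def cis by simp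
      qed
      then have "hopf_proj z \<in> V"
        using inM nz cis by (auto simp: V_def)
      moreover have "\<phi> (hopf_proj z) = z"
      proof -
        have "r * 2 powr (\<alpha> / (2 * pi)) = norm z"
          using r nz by (simp add: \<alpha>_def powr_diff)
        then show ?thesis
          using nz unfolding \<phi>_def th by (simp add: hopf_proj_def)
      qed
      ultimately show "z \<in> \<phi> ` V"
        by (metis imageI)
    qed
    moreover have "open {z :: complex ^ 'n. r * 2 powr (- 1/2) < norm z \<and> norm z < r * 2 powr (1/2)}"
      by (intro open_Collect_conj open_Collect_less continuous_intros)
    moreover have "0 \<notin> {z :: complex ^ 'n. r * 2 powr (- 1/2) < norm z \<and> norm z < r * 2 powr (1/2)}"
      using r by (simp add: not_less)
    ultimately have "(V, \<phi>) \<in> hopf_atlas"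
      by (simp add: hopf_atlas_def chart_image_def)
    moreover have "p \<in> V"
      using p t0 by (auto simp: V_def)
    ultimately show ?thesis
      by (metis fst_conv)
  qed
  have trans: "transition c c' differentiable (at z) \<and>
        (\<forall>a v. frechet_derivative (transition c c') (at z) (a *s v) =
               a *s frechet_derivative (transition c c') (at z) v)"
    if c: "c \<in> hopf_atlas" and c': "c' \<in> hopf_atlas" and z: "z \<in> snd c ` (fst c \<inter> fst c')"
    for c c' :: "((complex ^ 'n) \<times> complex, 'n) chart" and z
  proof -
    have ne: "x \<noteq> 0" if "x \<in> chart_image c \<or> x \<in> chart_image c'" for x
      using that c c' by (auto simp: hopf_atlas_def)
    obtain p where p: "p \<in> fst c" "p \<in> fst c'" "z = snd c p"
      using z by blast
    have T: "transition c c' x = snd c' (hopf_proj x)" if "x \<in> chart_image c" for x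
    proof -
      have "inv_into (fst c) (snd c) x = hopf_proj x"
        using that homeo[OF c] by (intro inv_into_f_eq) (auto simp: homeomorphism_def intro: inj_on_inverseI)
      then show ?thesis
        by (simp add: transition_def)
    qed
    have "hopf_proj (snd c' p) = hopf_proj z"
      using p c c' by (simp add: hopf_atlas_def)
    then obtain k :: int where k: "snd c' p = (1/2) powi k *\<^sub>R z"
      using hopf_proj_eq_iff[of z "snd c' p"] ne p by (auto simp: chart_image_def)
    define a :: real where "a = (1/2) powi k"
    define N where "N = chart_image c \<inter> {x. a *\<^sub>R x \<in> chart_image c'}"
    have "open N"
      unfolding N_def using c c'
      by (intro open_Int open_vimage[unfolded vimage_def] continuous_intros) (auto simp: hopf_atlas_def)
    moreover have "z \<in> N"
      using p unfolding N_def a_def chart_image_def Int_iff mem_Collect_eq k[symmetric] by blast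
    moreover have "transition c c' x = a *\<^sub>R x" if "x \<in> N" for x
    proof -
      obtain q where q: "q \<in> fst c'" "a *\<^sub>R x = snd c' q"
        using \<open>x \<in> N\<close> unfolding N_def chart_image_def by blast
      then have "q = hopf_proj (a *\<^sub>R x)"
        using c' by (simp add: hopf_atlas_def)
      also have "\<dots> = hopf_proj x"
        using hopf_proj_eq_iff[of x "a *\<^sub>R x"] that ne by (auto simp: N_def a_def)
      finally show ?thesis
        using T that q by (simp add: N_def)
    qed
    ultimately have der: "(transition c c' has_derivative (\<lambda>v. a *\<^sub>R v)) (at z)"
      using has_derivative_transform_within_open[of "\<lambda>v. a *\<^sub>R v" "\<lambda>v. a *\<^sub>R v" z UNIV N "transition c c'"]
        has_derivative_scaleR_right[OF has_derivative_ident, of a "at z"] by simp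
    have "frechet_derivative (transition c c') (at z) (b *s v) =
          b *s frechet_derivative (transition c c') (at z) v" for b v
      unfolding frechet_derivative_at[OF der, symmetric] by (simp add: vec_eq_iff)
    moreover have "transition c c' differentiable (at z)"
      using der unfolding differentiable_def by blast
    ultimately show ?thesis by blast
  qed
  have "fst c \<subseteq> hopf_manifold" "openin (top_of_set hopf_manifold) (fst c)" "open (chart_image c)"
    if "c \<in> hopf_atlas" for c :: "((complex ^ 'n) \<times> complex, 'n) chart"
    using that openin_imp_subset by (auto simp: hopf_atlas_def)
  note chart = this
  have "(\<Union>c\<in>hopf_atlas. fst c) = (hopf_manifold :: ((complex ^ 'n) \<times> complex) set)"
    using chart(1) cover by (intro equalityI UN_least subsetI) (auto intro: UN_I)
  moreover have "\<exists>inv. homeomorphism (fst c) (chart_image c) (snd c) inv"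
    if "c \<in> hopf_atlas" for c :: "((complex ^ 'n) \<times> complex, 'n) chart"
    using homeo[OF that] by blast
  ultimately show ?thesis
    unfolding complex_atlas_def using chart(2,3) trans by (intro conjI ballI) simp_all
qed

end

theory Submission
  imports Defs
begin

text \<open>
The trace of the curvature of the induced connection on \<open>T\<^sup>1\<^sup>,\<^sup>0\<close> is the first Levi-Civita Ricci form,
and the trace of a curvature is the differential of the trace of the connection form
(\<open>first_lc_ricci_form_eq\<close>). So all that is needed of the Levi-Civita connection is one scalar
one-form \<open>\<tau>\<close>: at a real vector \<open>u\<close> it is the complex trace of the \<open>\<complex>\<close>-linear part of the map
\<open>v \<mapsto> \<Gamma>(u, v)\<close>.

Put \<open>r = (norm z)\<^sup>2\<close>, and let \<open>P\<close> be the matrix with entries \<open>cnj z\<^sub>i z\<^sub>j / r\<close>, which is a projection.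
Both \<open>\<omega>\<^sub>0\<close> and \<open>\<omega>\<close> belong to the family of metrics \<open>(4a/r) (1 + \<kappa> P)\<close> with constants \<open>a > 0\<close> and
\<open>\<kappa> \<ge> 0\<close>. Their Christoffel symbols can be written down in closed form and checked against the
characterization of the Levi-Civita connection as the torsion-free metric one
(\<open>complex_christoffel_hopf_family\<close>); as this characterization determines the connection
(\<open>is_levi_civita_unique\<close>), they yield the actual \<open>\<tau>\<close>, namely

  \<open>\<tau>(u) = - (n Re s + \<i> \<mu> Im s) / r\<close>, where \<open>s = hprod u z\<close> and \<open>\<mu> = 1 + \<kappa> - n \<kappa>\<close>

(\<open>complex_trace_hopf_christoffel\<close>). The real part of \<open>\<tau>\<close> is a multiple of \<open>d ln r\<close> and is closed, and the
imaginary part is a multiple of \<open>\<mu> (\<partial> - \<partial>bar) ln r\<close>. Hence the Ricci form of the metric is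
\<open>\<mu> \<surd>-1 \<partial>\<partial>bar ln r\<close>, whose matrix is \<open>\<mu> (1 - P) / r\<close> (\<open>first_lc_ricci_form_hopf_family\<close>).

For \<open>\<omega>\<^sub>0\<close> one has \<open>\<kappa> = 0\<close> and \<open>\<mu> = 1\<close>, so that \<open>\<omega>\<close> has the matrix
\<open>4/r - (4/n) (1 - P) / r = (4/r) (1 - 1/n) (1 + P / (n - 1))\<close>. This is the member of the family with
\<open>\<kappa> = 1 / (n - 1)\<close>, for which \<open>\<mu>\<close> vanishes. It is positive definite as \<open>n \<ge> 2\<close>, and it is a global form
on the Hopf manifold because its coefficients are homogeneous of degree \<open>-2\<close> and the transition maps
of the atlas are locally multiplications by powers of \<open>1/2\<close> (\<open>hermitian_metric_on_hopf_family\<close>).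
\<close>

section \<open>Calculus of smooth maps\<close>

lemma has_derivative_cong_open:
  assumes "open U" "x \<in> U" "\<And>y. y \<in> U \<Longrightarrow> f y = g y"
  shows "(f has_derivative f') (at x) \<longleftrightarrow> (g has_derivative f') (at x)"
  using assms has_derivative_transform_within_open[of f f' x UNIV U g]
    has_derivative_transform_within_open[of g f' x UNIV U f] by auto

lemma frechet_derivative_cong_open:
  assumes "open U" "x \<in> U" "\<And>y. y \<in> U \<Longrightarrow> f y = g y"
  shows "frechet_derivative f (at x) = frechet_derivative g (at x)"
  unfolding frechet_derivative_def by (simp add: has_derivative_cong_open[OF assms])

lemma differentiable_cong_open:
  assumes "open U" "x \<in> U" "\<And>y. y \<in> U \<Longrightarrow> f y = g y"
  shows "f differentiable at x \<longleftrightarrow> g differentiable at x"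
  unfolding differentiable_def by (simp add: has_derivative_cong_open[OF assms])

lemma differentiable_on_open:
  "open U \<Longrightarrow> f differentiable_on U \<longleftrightarrow> (\<forall>x\<in>U. f differentiable at x)"
  by (simp add: differentiable_on_eq_differentiable_at)

lemma ck_on_cong:
  assumes "open U" "\<And>x. x \<in> U \<Longrightarrow> f x = g x"
  shows "ck_on k U f \<longleftrightarrow> ck_on k U g"
  using assms(2)
proof (induction k arbitrary: f g)
  case 0
  then show ?case using continuous_on_cong[of U U f g] by simp
next
  case (Suc k)
  have "ck_on k U (\<lambda>x. frechet_derivative f (at x) v) = ck_on k U (\<lambda>x. frechet_derivative g (at x) v)" for v
    by (rule Suc.IH) (simp add: frechet_derivative_cong_open[OF assms(1) _ Suc.prems])
  then show ?case
    using differentiable_cong_open[OF assms(1) _ Suc.prems]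
    by (auto simp: differentiable_on_open[OF assms(1)])
qed

lemma ck_on_mono: "ck_on (Suc k) U f \<Longrightarrow> ck_on k U f"
  by (induction k arbitrary: f) (auto intro: differentiable_imp_continuous_on)

text \<open>
The recursive clause with the \<^const>\<open>frechet_derivative\<close> replaced by any known derivative. All closure
properties below are inductions on the order of differentiability in which this rule is applied to
the usual formula for the derivative.
\<close>

lemma ck_on_SucI:
  assumes "open U" "\<And>x. x \<in> U \<Longrightarrow> (f has_derivative f' x) (at x)"
    and "\<And>v. ck_on k U (\<lambda>x. f' x v)"
  shows "ck_on (Suc k) U f"
proof -
  have "ck_on k U (\<lambda>x. frechet_derivative f (at x) v) = ck_on k U (\<lambda>x. f' x v)" for v
    by (rule ck_on_cong[OF assms(1)]) (simp add: frechet_derivative_at[OF assms(2), symmetric])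
  then show ?thesis
    using assms by (auto simp: differentiable_on_open differentiable_def)
qed

lemma ck_on_Suc_has_derivative:
  assumes "open U" "ck_on (Suc k) U f" "x \<in> U"
  shows "(f has_derivative frechet_derivative f (at x)) (at x)"
  using assms by (simp add: differentiable_on_open frechet_derivative_works)

lemma ck_on_const: "open U \<Longrightarrow> ck_on k U (\<lambda>x. c)"
proof (induction k arbitrary: c)
  case (Suc k)
  then show ?case by (intro ck_on_SucI[where f' = "\<lambda>_ _. 0"]) auto
qed simp

lemma ck_on_linear_compose:
  assumes "open U" "bounded_linear L"
  shows "ck_on k U f \<Longrightarrow> ck_on k U (\<lambda>x. L (f x))"
proof (induction k arbitrary: f)
  case 0
  then show ?case by (simp add: bounded_linear.continuous_on[OF assms(2)])
next
  case (Suc k)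
  show ?case
  proof (rule ck_on_SucI[OF assms(1)])
    show "((\<lambda>x. L (f x)) has_derivative (\<lambda>v. L (frechet_derivative f (at x) v))) (at x)" if "x \<in> U" for x
      by (rule bounded_linear.has_derivative[OF assms(2)])
        (rule ck_on_Suc_has_derivative[OF assms(1) Suc.prems that])
    show "ck_on k U (\<lambda>x. L (frechet_derivative f (at x) v))" for v
      using Suc.prems by (intro Suc.IH) simp
  qed
qed

lemma ck_on_add:
  assumes "open U"
  shows "ck_on k U f \<Longrightarrow> ck_on k U g \<Longrightarrow> ck_on k U (\<lambda>x. f x + g x)"
proof (induction k arbitrary: f g)
  case 0
  then show ?case by (simp add: continuous_on_add)
next
  case (Suc k)
  show ?case
  proof (rule ck_on_SucI[OF assms(1)])
    show "((\<lambda>x. f x + g x) has_derivative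
        (\<lambda>v. frechet_derivative f (at x) v + frechet_derivative g (at x) v)) (at x)" if "x \<in> U" for x
      by (rule has_derivative_add[OF ck_on_Suc_has_derivative[OF assms(1) Suc.prems(1) that]
            ck_on_Suc_has_derivative[OF assms(1) Suc.prems(2) that]])
    show "ck_on k U (\<lambda>x. frechet_derivative f (at x) v + frechet_derivative g (at x) v)" for v
      using Suc.prems by (intro Suc.IH) simp_all
  qed
qed

lemma ck_on_bilinear:
  assumes "open U" "bounded_bilinear B"
  shows "ck_on k U f \<Longrightarrow> ck_on k U g \<Longrightarrow> ck_on k U (\<lambda>x. B (f x) (g x))"
proof (induction k arbitrary: f g)
  case 0
  then show ?case by (simp add: bounded_bilinear.continuous_on[OF assms(2)])
next
  case (Suc k)
  show ?case
  proof (rule ck_on_SucI[OF assms(1)])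
    show "((\<lambda>x. B (f x) (g x)) has_derivative
        (\<lambda>v. B (f x) (frechet_derivative g (at x) v) + B (frechet_derivative f (at x) v) (g x))) (at x)"
      if "x \<in> U" for x
      by (rule bounded_bilinear.FDERIV[OF assms(2) ck_on_Suc_has_derivative[OF assms(1) Suc.prems(1) that]
            ck_on_Suc_has_derivative[OF assms(1) Suc.prems(2) that]])
    show "ck_on k U (\<lambda>x. B (f x) (frechet_derivative g (at x) v) + B (frechet_derivative f (at x) v) (g x))" for v
      using Suc.prems ck_on_mono[OF Suc.prems(1)] ck_on_mono[OF Suc.prems(2)]
      by (intro ck_on_add[OF assms(1)] Suc.IH) simp_all
  qed
qed

text \<open>
The derivative \<open>- f' / f\<^sup>2\<close> contains \<open>1 / f\<close> again, one order of differentiability lower, which is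
what the induction hypothesis supplies.
\<close>

lemma ck_on_inverse:
  fixes f :: "'a::euclidean_space \<Rightarrow> real"
  assumes "open U" "\<And>x. x \<in> U \<Longrightarrow> f x \<noteq> 0"
  shows "ck_on k U f \<Longrightarrow> ck_on k U (\<lambda>x. inverse (f x))"
proof (induction k)
  case 0
  then show ?case using assms(2) by (simp add: continuous_on_inverse)
next
  case (Suc k)
  show ?case
  proof (rule ck_on_SucI[OF assms(1)])
    show "((\<lambda>x. inverse (f x)) has_derivative
        (\<lambda>v. - (inverse (f x) * frechet_derivative f (at x) v * inverse (f x)))) (at x)" if "x \<in> U" for x
      by (rule Deriv.has_derivative_inverse[OF assms(2)[OF that]
            ck_on_Suc_has_derivative[OF assms(1) Suc.prems that]])
    have inv: "ck_on k U (\<lambda>x. inverse (f x))"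
      using Suc.IH ck_on_mono[OF Suc.prems] by simp
    show "ck_on k U (\<lambda>x. - (inverse (f x) * frechet_derivative f (at x) v * inverse (f x)))" for v
      using Suc.prems
      by (intro ck_on_linear_compose[OF assms(1) bounded_linear_minus[OF bounded_linear_ident]]
          ck_on_bilinear[OF assms(1) bounded_bilinear_mult] inv) simp
  qed
qed

lemma smooth_on_cong:
  assumes "open U" "\<And>x. x \<in> U \<Longrightarrow> f x = g x"
  shows "smooth_on U f \<longleftrightarrow> smooth_on U g"
  using ck_on_cong[OF assms] by (simp add: smooth_on_def)

lemma smooth_on_has_derivative:
  assumes "open U" "smooth_on U f" "x \<in> U"
  shows "(f has_derivative frechet_derivative f (at x)) (at x)"
  using assms ck_on_Suc_has_derivative unfolding smooth_on_def by blast

named_theorems smooth_intros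

lemma smooth_on_const [smooth_intros]: "open U \<Longrightarrow> smooth_on U (\<lambda>x. c)"
  by (simp add: smooth_on_def ck_on_const)

lemma smooth_on_linear_compose:
  "bounded_linear L \<Longrightarrow> open U \<Longrightarrow> smooth_on U f \<Longrightarrow> smooth_on U (\<lambda>x. L (f x))"
  by (simp add: smooth_on_def ck_on_linear_compose)

lemma smooth_on_bilinear:
  "bounded_bilinear B \<Longrightarrow> open U \<Longrightarrow> smooth_on U f \<Longrightarrow> smooth_on U g \<Longrightarrow> smooth_on U (\<lambda>x. B (f x) (g x))"
  by (simp add: smooth_on_def ck_on_bilinear)

lemma smooth_on_ident [smooth_intros]:
  assumes "open U" shows "smooth_on U (\<lambda>x. x)"
proof -
  have "ck_on k U (\<lambda>x. x)" for k
    by (cases k) (auto intro!: ck_on_SucI[where f' = "\<lambda>_ v. v"] assms ck_on_const simp del: ck_on.simps(2))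
  then show ?thesis by (simp add: smooth_on_def)
qed

lemma smooth_on_add [smooth_intros]:
  "open U \<Longrightarrow> smooth_on U f \<Longrightarrow> smooth_on U g \<Longrightarrow> smooth_on U (\<lambda>x. f x + g x)"
  by (simp add: smooth_on_def ck_on_add)

lemmas smooth_on_scaleR [smooth_intros] = smooth_on_bilinear[OF bounded_bilinear_scaleR]
lemmas smooth_on_mult [smooth_intros] =
  smooth_on_bilinear[OF bounded_bilinear_mult[where 'a = "'a::real_normed_algebra"]]
lemmas smooth_on_inner [smooth_intros] = smooth_on_bilinear[OF bounded_bilinear_inner]
lemmas smooth_on_minus [smooth_intros] =
  smooth_on_linear_compose[OF bounded_linear_minus[OF bounded_linear_ident]]
lemmas smooth_on_of_real [smooth_intros] = smooth_on_linear_compose[OF bounded_linear_of_real]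
lemmas smooth_on_Re [smooth_intros] = smooth_on_linear_compose[OF bounded_linear_Re]
lemmas smooth_on_Im [smooth_intros] = smooth_on_linear_compose[OF bounded_linear_Im]
lemmas smooth_on_cnj [smooth_intros] = smooth_on_linear_compose[OF bounded_linear_cnj]
lemmas smooth_on_vec_nth [smooth_intros] = smooth_on_linear_compose[OF bounded_linear_vec_nth]

lemma smooth_on_diff [smooth_intros]:
  "open U \<Longrightarrow> smooth_on U f \<Longrightarrow> smooth_on U g \<Longrightarrow> smooth_on U (\<lambda>x. f x - g x)"
  using smooth_on_add[of U f "\<lambda>x. - g x"] smooth_on_minus[of U g] by simp

lemma smooth_on_inverse [smooth_intros]:
  fixes f :: "'a::euclidean_space \<Rightarrow> real"
  shows "open U \<Longrightarrow> smooth_on U f \<Longrightarrow> (\<And>x. x \<in> U \<Longrightarrow> f x \<noteq> 0) \<Longrightarrow> smooth_on U (\<lambda>x. inverse (f x))"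
  by (simp add: smooth_on_def ck_on_inverse)

lemma smooth_on_sum [smooth_intros]:
  "open U \<Longrightarrow> (\<And>i. i \<in> I \<Longrightarrow> smooth_on U (f i)) \<Longrightarrow> smooth_on U (\<lambda>x. \<Sum>i\<in>I. f i x)"
  by (induction I rule: infinite_finite_induct) (simp_all add: smooth_on_const smooth_on_add)

lemma smooth_on_vec_lambda [smooth_intros]:
  fixes f :: "'n::finite \<Rightarrow> 'a::euclidean_space \<Rightarrow> 'b::real_normed_vector"
  assumes "open U" "\<And>i. smooth_on U (f i)"
  shows "smooth_on U (\<lambda>x. \<chi> i. f i x)"
proof -
  have "norm (axis i y :: 'b ^ 'n) \<le> norm y" for i y
    unfolding norm_vec_def by (rule order_trans[OF L2_set_le_sum]) (simp_all add: axis_def if_distrib cong: if_cong)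
  then have "bounded_linear (\<lambda>y. axis i y :: 'b ^ 'n)" for i
    by (intro bounded_linear_intro[where K = 1]) (auto simp: vec_eq_iff axis_def)
  then have "smooth_on U (\<lambda>x. \<Sum>i\<in>UNIV. axis i (f i x))"
    using assms by (intro smooth_on_sum smooth_on_linear_compose[where L = "axis _"])
  moreover have "(\<Sum>i\<in>UNIV. axis i (f i x)) = (\<chi> i. f i x)" for x
    by (simp add: vec_eq_iff axis_def)
  ultimately show ?thesis by simp
qed

text \<open>
The definition of smoothness speaks of derivatives in constant directions only; a variable
direction is expanded in the standard basis.
\<close>

lemma smooth_on_lie_derivative [smooth_intros]:
  assumes "open U" "smooth_on U f" "smooth_on U X"
  shows "smooth_on U (lie_derivative X f)"
proof -
  have lin: "linear (frechet_derivative f (at x))" if "x \<in> U" for x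
    using smooth_on_has_derivative[OF assms(1,2) that] by (rule has_derivative_linear)
  have "ck_on (Suc k) U f" for k
    using assms(2) unfolding smooth_on_def by blast
  then have "smooth_on U (\<lambda>x. frechet_derivative f (at x) b)" for b
    by (simp add: smooth_on_def)
  then have "smooth_on U (\<lambda>x. \<Sum>b\<in>Basis. (X x \<bullet> b) *\<^sub>R frechet_derivative f (at x) b)"
    using assms(1,3) by (intro smooth_intros) auto
  moreover have "lie_derivative X f x = (\<Sum>b\<in>Basis. (X x \<bullet> b) *\<^sub>R frechet_derivative f (at x) b)"
    if "x \<in> U" for x
  proof -
    have "frechet_derivative f (at x) (X x) = frechet_derivative f (at x) (\<Sum>b\<in>Basis. (X x \<bullet> b) *\<^sub>R b)"
      by (simp add: euclidean_representation)
    then show ?thesis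
      by (simp add: lie_derivative_def linear_sum[OF lin[OF that]] linear_scale[OF lin[OF that]])
  qed
  ultimately show ?thesis
    by (subst smooth_on_cong[OF assms(1)]) auto
qed

section \<open>The Levi-Civita connection from Christoffel symbols\<close>

lemma lie_derivative_eq: "(f has_derivative f') (at x) \<Longrightarrow> lie_derivative X f x = f' (X x)"
  by (simp add: lie_derivative_def frechet_derivative_at[symmetric])

text \<open>
The difference \<open>\<delta>\<close> of two Levi-Civita connections is symmetric because both are torsion-free, and
\<open>g (\<delta> Z V) W\<close> is skew in \<open>V\<close> and \<open>W\<close> because both are metric. A trilinear expression that is
symmetric in one pair of arguments and skew in another vanishes: three alternating exchanges bring
\<open>g (\<delta> X Y) Z\<close> back to itself with a minus sign.
\<close>

lemma is_levi_civita_unique: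
  assumes bil: "\<And>x. x \<in> U \<Longrightarrow> bilinear (g x)"
    and sym: "\<And>x u v. x \<in> U \<Longrightarrow> g x u v = g x v u"
    and nondeg: "\<And>x u. x \<in> U \<Longrightarrow> (\<And>w. g x u w = 0) \<Longrightarrow> u = 0"
    and "open U" "is_levi_civita U g D" "is_levi_civita U g D'"
    and "smooth_on U X" "smooth_on U Y" "x \<in> U"
  shows "D X Y x = D' X Y x"
proof -
  define \<delta> where "\<delta> V W = D V W x - D' V W x" for V W
  have \<delta>_sym: "\<delta> V W = \<delta> W V" if "smooth_on U V" "smooth_on U W" for V W
  proof -
    have "D V W x - D W V x = lie_bracket V W x" "D' V W x - D' W V x = lie_bracket V W x"
      using assms(5,6) that \<open>x \<in> U\<close> unfolding is_levi_civita_def by blast+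
    moreover have "\<delta> V W - \<delta> W V = (D V W x - D W V x) - (D' V W x - D' W V x)"
      by (simp add: \<delta>_def)
    ultimately show ?thesis by simp
  qed
  have \<delta>_skew: "g x (\<delta> Z V) (W x) = - g x (V x) (\<delta> Z W)"
    if "smooth_on U V" "smooth_on U W" "smooth_on U Z" for V W Z
  proof -
    have "lie_derivative Z (\<lambda>y. g y (V y) (W y)) x = g x (D Z V x) (W x) + g x (V x) (D Z W x)"
      "lie_derivative Z (\<lambda>y. g y (V y) (W y)) x = g x (D' Z V x) (W x) + g x (V x) (D' Z W x)"
      using assms(5,6) that \<open>x \<in> U\<close> unfolding is_levi_civita_def by blast+
    then show ?thesis
      by (simp add: \<delta>_def bilinear_lsub[OF bil[OF \<open>x \<in> U\<close>]] bilinear_rsub[OF bil[OF \<open>x \<in> U\<close>]])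
  qed
  have "g x (\<delta> X Y) w = 0" for w
  proof -
    define Z where "Z = (\<lambda>_ :: 'a. w)"
    have Z: "smooth_on U Z" using \<open>open U\<close> by (simp add: Z_def smooth_on_const)
    note XYZ = \<open>smooth_on U X\<close> \<open>smooth_on U Y\<close> Z
    have "g x (\<delta> X Y) w = - g x (Y x) (\<delta> Z X)"
      using \<delta>_skew[OF XYZ(2) Z XYZ(1)] \<delta>_sym[OF XYZ(1) Z] by (simp add: Z_def)
    also have "\<dots> = g x (X x) (\<delta> Y Z)"
      using \<delta>_skew[OF XYZ(1,2) Z] \<delta>_sym[OF Z XYZ(2)] sym[OF \<open>x \<in> U\<close>, of "Y x"] by simp
    also have "\<dots> = - g x (\<delta> X Y) w"
      using \<delta>_skew[OF Z XYZ(1,2)] \<delta>_sym[OF XYZ(1,2)] sym[OF \<open>x \<in> U\<close>, of "X x"] sym[OF \<open>x \<in> U\<close>, of w]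
      by (simp add: Z_def)
    finally show ?thesis by simp
  qed
  then have "\<delta> X Y = 0" using nondeg[OF \<open>x \<in> U\<close>] by blast
  then show ?thesis by (simp add: \<delta>_def)
qed

text \<open>
A candidate for the Christoffel symbols of \<open>g\<close>. The assumption \<open>g_parallel\<close> is the Leibniz rule
\<open>d (g X Y) = g (\<nabla> X) Y + g X (\<nabla> Y)\<close> at a single point, for fields that are only differentiable
there. Giving the symbols explicitly makes the existence of the Levi-Civita connection a
verification; uniqueness then turns the unspecified choice in \<^const>\<open>levi_civita\<close> into a formula.
\<close>

locale metric_christoffel =
  fixes U :: "'a::euclidean_space set"
    and g :: "'a \<Rightarrow> 'a \<Rightarrow> 'a \<Rightarrow> real"
    and \<Gamma> :: "'a \<Rightarrow> 'a \<Rightarrow> 'a \<Rightarrow> 'a"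
  assumes open_domain: "open U"
    and g_bilinear: "x \<in> U \<Longrightarrow> bilinear (g x)"
    and g_sym: "x \<in> U \<Longrightarrow> g x u v = g x v u"
    and g_nondegenerate: "x \<in> U \<Longrightarrow> (\<And>w. g x u w = 0) \<Longrightarrow> u = 0"
    and \<Gamma>_bilinear: "x \<in> U \<Longrightarrow> bilinear (\<Gamma> x)"
    and \<Gamma>_sym: "x \<in> U \<Longrightarrow> \<Gamma> x u v = \<Gamma> x v u"
    and \<Gamma>_smooth: "smooth_on U X \<Longrightarrow> smooth_on U Y \<Longrightarrow> smooth_on U (\<lambda>x. \<Gamma> x (X x) (Y x))"
    and g_parallel: "x \<in> U \<Longrightarrow> (X has_derivative X') (at x) \<Longrightarrow> (Y has_derivative Y') (at x) \<Longrightarrow>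
      ((\<lambda>y. g y (X y) (Y y)) has_derivative
        (\<lambda>w. g x (X' w + \<Gamma> x w (X x)) (Y x) + g x (X x) (Y' w + \<Gamma> x w (Y x)))) (at x)"
begin

lemma is_levi_civita_christoffel:
  "is_levi_civita U g (\<lambda>X Y x. lie_derivative X Y x + \<Gamma> x (X x) (Y x))"
proof -
  note der = smooth_on_has_derivative[OF open_domain]
  have add: "lie_derivative X (\<lambda>y. Y y + Y' y) x = lie_derivative X Y x + lie_derivative X Y' x"
    if "smooth_on U Y" "smooth_on U Y'" "x \<in> U" for X :: "'a \<Rightarrow> 'a" and Y Y' :: "'a \<Rightarrow> 'a" and x
    using lie_derivative_eq[OF has_derivative_add[OF der[OF that(1,3)] der[OF that(2,3)]], of X]
    by (simp add: lie_derivative_def)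
  have scale: "lie_derivative X (\<lambda>y. f y *\<^sub>R Y y) x =
      f x *\<^sub>R lie_derivative X Y x + lie_derivative X f x *\<^sub>R Y x"
    if "smooth_on U f" "smooth_on U Y" "x \<in> U" for X Y :: "'a \<Rightarrow> 'a" and f :: "'a \<Rightarrow> real" and x
    using lie_derivative_eq[OF has_derivative_scaleR[OF der[OF that(1,3)] der[OF that(2,3)]], of X]
    by (simp add: lie_derivative_def)
  have field_add: "lie_derivative (\<lambda>y. X y + X' y) Y x = lie_derivative X Y x + lie_derivative X' Y x"
    and field_scale: "lie_derivative (\<lambda>y. f y *\<^sub>R X y) Y x = f x *\<^sub>R lie_derivative X Y x"
    if "smooth_on U Y" "x \<in> U" for X X' Y :: "'a \<Rightarrow> 'a" and f x
    using has_derivative_linear[OF der[OF that]]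
    by (simp_all add: lie_derivative_def linear_add linear_scale)
  have "affine_connection U (\<lambda>X Y x. lie_derivative X Y x + \<Gamma> x (X x) (Y x))"
    unfolding affine_connection_def
  proof (intro conjI allI impI ballI; (elim conjE)?)
    fix X Y :: "'a \<Rightarrow> 'a" assume "smooth_on U X" "smooth_on U Y"
    then show "smooth_on U (\<lambda>x. lie_derivative X Y x + \<Gamma> x (X x) (Y x))"
      by (intro smooth_on_add smooth_on_lie_derivative \<Gamma>_smooth open_domain)
  qed (simp_all only: add scale field_add field_scale bilinear_ladd[OF \<Gamma>_bilinear] bilinear_radd[OF \<Gamma>_bilinear]
        bilinear_lmul[OF \<Gamma>_bilinear] bilinear_rmul[OF \<Gamma>_bilinear] scaleR_add_right ac_simps)
  moreover have "lie_derivative Z (\<lambda>y. g y (X y) (Y y)) x =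
      g x (lie_derivative Z X x + \<Gamma> x (Z x) (X x)) (Y x) + g x (X x) (lie_derivative Z Y x + \<Gamma> x (Z x) (Y x))"
    if "smooth_on U X" "smooth_on U Y" "x \<in> U" for X Y Z x
    using lie_derivative_eq[OF g_parallel[OF that(3) der[OF that(1,3)] der[OF that(2,3)]], of Z]
    by (simp add: lie_derivative_def)
  ultimately show ?thesis
    by (simp add: is_levi_civita_def lie_bracket_def \<Gamma>_sym)
qed

lemma levi_civita_eq:
  assumes "smooth_on U X" "smooth_on U Y" "x \<in> U"
  shows "levi_civita U g X Y x = lie_derivative X Y x + \<Gamma> x (X x) (Y x)"
proof -
  have "is_levi_civita U g (levi_civita U g)"
    unfolding levi_civita_def by (rule someI[of "is_levi_civita U g", OF is_levi_civita_christoffel])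
  from is_levi_civita_unique[OF g_bilinear g_sym g_nondegenerate open_domain this is_levi_civita_christoffel assms]
  show ?thesis by simp
qed

end

section \<open>The induced connection on the holomorphic tangent bundle\<close>

text \<open>
The isomorphism from \<open>\<complex>\<^sup>n\<close> to the \<open>\<surd>-1\<close>-eigenspace \<open>T\<^sup>1\<^sup>,\<^sup>0\<close> of \<^const>\<open>cplx_J\<close> that sends the standard
basis to the vectors \<open>\<partial>/\<partial>z\<^sup>k\<close>. It turns sections of \<open>T\<^sup>1\<^sup>,\<^sup>0\<close> into \<open>\<complex>\<^sup>n\<close>-valued functions.
\<close>

definition hol_vec :: "complex ^ 'n::finite \<Rightarrow> 'n cvec" where
  "hol_vec q = (1/2) *\<^sub>R (q, - cplx_J q)"

text \<open>
The \<open>\<complex>\<close>-linear part in the splitting of a real-linear map of \<open>\<complex>\<^sup>n\<close> into a \<open>\<complex>\<close>-linear and a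
conjugate-linear one.
\<close>

definition complex_part :: "(complex ^ 'n \<Rightarrow> complex ^ 'n::finite) \<Rightarrow> complex ^ 'n \<Rightarrow> complex ^ 'n" where
  "complex_part L v = (1/2) *\<^sub>R (L v - cplx_J (L (cplx_J v)))"

definition complex_trace :: "(complex ^ 'n \<Rightarrow> complex ^ 'n::finite) \<Rightarrow> complex" where
  "complex_trace L = (\<Sum>k\<in>UNIV. complex_part L (axis k 1) $ k)"

definition cvec_derivative :: "'n::finite cvec \<Rightarrow> (complex ^ 'n \<Rightarrow> complex) \<Rightarrow> complex ^ 'n \<Rightarrow> complex" where
  "cvec_derivative X f x = frechet_derivative f (at x) (fst X) + \<i> * frechet_derivative f (at x) (snd X)"

lemma bounded_linear_cplx_J: "bounded_linear (cplx_J :: complex ^ 'n::finite \<Rightarrow> _)"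
  by (rule linear_conv_bounded_linear[THEN iffD1], rule linearI) (simp_all add: cplx_J_def vec_eq_iff algebra_simps)

lemmas smooth_on_cplx_J [smooth_intros] = smooth_on_linear_compose[OF bounded_linear_cplx_J]

lemma cplx_J_simps [simp]:
  "cplx_J (cplx_J v) = - v" "cplx_J (u + v) = cplx_J u + cplx_J v" "cplx_J (u - v) = cplx_J u - cplx_J v"
  "cplx_J (- v) = - cplx_J v" "cplx_J (a *\<^sub>R v) = a *\<^sub>R cplx_J v" "cplx_J 0 = 0" "cplx_J v $ l = \<i> * v $ l"
  by (simp_all add: cplx_J_def vec_eq_iff algebra_simps)

lemma d_z_eq_hol_vec: "d_z k = hol_vec (axis k 1)"
  by (simp add: d_z_def hol_vec_def)

lemma dz_hol_vec: "dz l (hol_vec q) = q $ l"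
  by (simp add: dz_def hol_vec_def scaleR_conv_of_real[where 'a = complex])

lemma dz_diff: "dz l (V - W) = dz l V - dz l W"
  by (simp add: dz_def algebra_simps)

lemma proj10_eq_hol_vec: "proj10 W = hol_vec (fst W + cplx_J (snd W))"
  by (simp add: proj10_def hol_vec_def)

lemma complex_scale_decomp: "c *s v = Re c *\<^sub>R v + Im c *\<^sub>R cplx_J (v :: complex ^ 'n)"
  by (simp add: vec_eq_iff complex_eq_iff)

lemma complex_part_add: "linear L \<Longrightarrow> complex_part L (u + v) = complex_part L u + complex_part L v"
  by (simp add: complex_part_def linear_add algebra_simps)

lemma complex_part_scale:
  assumes "linear L" shows "complex_part L (c *s v) = c *s complex_part L v"
  unfolding complex_scale_decomp
  by (simp add: complex_part_def linear_add[OF assms] linear_diff[OF assms] linear_scale[OF assms]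
      linear_neg[OF assms] algebra_simps)

text \<open>
For \<open>\<complex>\<close>-linear maps, this is \<open>tr (F G) = tr (G F)\<close>. It makes the commutator of the connection
matrices disappear from the trace of the curvature.
\<close>

lemma trace_product_commute:
  assumes F: "\<And>u v. F (u + v) = F u + F v" "\<And>c v. F (c *s v) = c *s F v"
    and G: "\<And>u v. G (u + v) = G u + G v" "\<And>c v. G (c *s v) = c *s G v"
  shows "(\<Sum>k\<in>UNIV. F (G (axis k 1)) $ k) = (\<Sum>k\<in>UNIV. G (F (axis k 1)) $ (k::'n::finite) :: complex)"
proof -
  have lin: "Vector_Spaces.linear (*s) (*s) F" "Vector_Spaces.linear (*s) (*s) G"
    using assms by (unfold_locales; simp)+
  have "trace (matrix (F \<circ> G)) = trace (matrix (G \<circ> F))"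
    unfolding matrix_compose_gen[OF lin(2) lin(1)] matrix_compose_gen[OF lin(1) lin(2)] by (rule trace_mul_sym)
  then show ?thesis by (simp add: trace_def matrix_def)
qed

locale complex_christoffel = metric_christoffel U g \<Gamma>
  for U :: "(complex ^ 'n::finite) set" and g \<Gamma>
begin

text \<open>
Under \<^const>\<open>hol_vec\<close> the projection to \<open>T\<^sup>1\<^sup>,\<^sup>0\<close> of the Levi-Civita connection becomes the flat derivative
plus a matrix of one-forms, and the projection is exactly what replaces \<open>\<Gamma>\<close> by its \<open>\<complex>\<close>-linear part.
Both are extended \<open>\<complex>\<close>-linearly in the direction \<open>X\<close>; the extra imaginary unit acts on \<open>T\<^sup>1\<^sup>,\<^sup>0\<close> as
\<^const>\<open>cplx_J\<close>.
\<close>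

definition conn_form :: "complex ^ 'n \<Rightarrow> 'n cvec \<Rightarrow> complex ^ 'n \<Rightarrow> complex ^ 'n" where
  "conn_form x X v = complex_part (\<Gamma> x (fst X)) v + cplx_J (complex_part (\<Gamma> x (snd X)) v)"

definition conn_trace :: "'n cvec \<Rightarrow> complex ^ 'n \<Rightarrow> complex" where
  "conn_trace X x = complex_trace (\<Gamma> x (fst X)) + \<i> * complex_trace (\<Gamma> x (snd X))"

lemma linear_\<Gamma>: "x \<in> U \<Longrightarrow> linear (\<Gamma> x u)"
  using \<Gamma>_bilinear by (simp add: bilinear_def)

lemma conn_form_add: "x \<in> U \<Longrightarrow> conn_form x X (u + v) = conn_form x X u + conn_form x X v"
  by (simp add: conn_form_def complex_part_add[OF linear_\<Gamma>])

lemma conn_form_scale: "x \<in> U \<Longrightarrow> conn_form x X (c *s v) = c *s conn_form x X v"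
  by (simp add: conn_form_def complex_part_scale[OF linear_\<Gamma>] vec_eq_iff algebra_simps)

lemma conn_trace_eq: "conn_trace X x = (\<Sum>k\<in>UNIV. conn_form x X (axis k 1) $ k)"
  by (simp add: conn_trace_def complex_trace_def conn_form_def sum.distrib sum_distrib_left)

lemma smooth_on_conn_form: "smooth_on U q \<Longrightarrow> smooth_on U (\<lambda>x. conn_form x X (q x))"
  unfolding conn_form_def complex_part_def
  by (intro smooth_intros \<Gamma>_smooth open_domain)

text \<open>
The field \<open>s\<close> is prescribed on \<open>U\<close> alone, because the lemma is to be applied to a field which is
itself a covariant derivative and known only there.
\<close>

lemma induced_connection_hol_vec:
  assumes q: "smooth_on U q" and s: "\<And>y. y \<in> U \<Longrightarrow> s y = hol_vec (q y)" and x: "x \<in> U"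
  shows "induced_connection (levi_civita U g) (\<lambda>_. X) s x =
    hol_vec (\<chi> l. cvec_derivative X (\<lambda>y. q y $ l) x + conn_form x X (q x) $ l)"
proof -
  define q' where "q' = frechet_derivative q (at x)"
  have q': "(q has_derivative q') (at x)"
    unfolding q'_def by (rule smooth_on_has_derivative[OF open_domain q x])
  define s1 s2 where "s1 = fst \<circ> s" and "s2 = snd \<circ> s"
  have s1: "s1 y = (1/2) *\<^sub>R q y" and s2: "s2 y = (- (1/2)) *\<^sub>R cplx_J (q y)" if "y \<in> U" for y
    using s[OF that] by (simp_all add: s1_def s2_def hol_vec_def)
  have d1: "(s1 has_derivative (\<lambda>v. (1/2) *\<^sub>R q' v)) (at x)"
    by (rule has_derivative_cong_open[OF open_domain x s1, THEN iffD2]) (auto intro!: derivative_eq_intros q')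
  have d2: "(s2 has_derivative (\<lambda>v. (- (1/2)) *\<^sub>R cplx_J (q' v))) (at x)"
    by (rule has_derivative_cong_open[OF open_domain x s2, THEN iffD2], assumption)
      (intro has_derivative_scaleR_right bounded_linear.has_derivative[OF bounded_linear_cplx_J] q')
  have sm1: "smooth_on U s1"
    by (rule smooth_on_cong[OF open_domain s1, THEN iffD2], assumption) (intro smooth_intros open_domain q)
  have sm2: "smooth_on U s2"
    by (rule smooth_on_cong[OF open_domain s2, THEN iffD2], assumption) (intro smooth_intros open_domain q)
  have D1: "levi_civita U g (\<lambda>_. u) s1 x = (1/2) *\<^sub>R (q' u + \<Gamma> x u (q x))"
    and D2: "levi_civita U g (\<lambda>_. u) s2 x = (- (1/2)) *\<^sub>R (cplx_J (q' u) + \<Gamma> x u (cplx_J (q x)))" for u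
    using levi_civita_eq[OF smooth_on_const[OF open_domain] sm1 x, of u]
      levi_civita_eq[OF smooth_on_const[OF open_domain] sm2 x, of u]
    unfolding lie_derivative_eq[OF d1] lie_derivative_eq[OF d2] s1[OF x] s2[OF x]
    by (simp_all only: linear_scale[OF linear_\<Gamma>[OF x]] scaleR_add_right)
  have comp: "frechet_derivative (\<lambda>y. q y $ l) (at x) = (\<lambda>v. q' v $ l)" for l
    by (rule frechet_derivative_at[symmetric])
      (rule bounded_linear.has_derivative[OF bounded_linear_vec_nth q'])
  have const: "fst \<circ> (\<lambda>_. X) = (\<lambda>_. fst X)" "snd \<circ> (\<lambda>_. X) = (\<lambda>_. snd X)" by auto
  have "induced_connection (levi_civita U g) (\<lambda>_. X) s x =
      hol_vec (q' (fst X) + cplx_J (q' (snd X)) + conn_form x X (q x))"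
    unfolding induced_connection_def complexify_op_def proj10_eq_hol_vec const fst_conv snd_conv
      s1_def[symmetric] s2_def[symmetric] D1 D2
    by (rule arg_cong[where f = hol_vec])
      (simp add: conn_form_def complex_part_def vec_eq_iff scaleR_conv_of_real[where 'a = complex] field_simps)
  also have "q' (fst X) + cplx_J (q' (snd X)) + conn_form x X (q x) =
      (\<chi> l. cvec_derivative X (\<lambda>y. q y $ l) x + conn_form x X (q x) $ l)"
    by (simp add: vec_eq_iff cvec_derivative_def comp)
  finally show ?thesis .
qed

lemma cvec_derivative_const [simp]: "cvec_derivative X (\<lambda>_. c) x = 0"
  by (simp add: cvec_derivative_def)

lemma induced_connection_const_twice:
  assumes x: "x \<in> U"
  shows "induced_connection (levi_civita U g) (\<lambda>_. X)
      (induced_connection (levi_civita U g) (\<lambda>_. Y) (\<lambda>_. hol_vec v)) x =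
    hol_vec (\<chi> l. cvec_derivative X (\<lambda>y. conn_form y Y v $ l) x + conn_form x X (conn_form x Y v) $ l)"
proof (rule induced_connection_hol_vec[OF _ _ x])
  show "smooth_on U (\<lambda>y. conn_form y Y v)"
    by (intro smooth_on_conn_form smooth_intros open_domain)
  show "induced_connection (levi_civita U g) (\<lambda>_. Y) (\<lambda>_. hol_vec v) y = hol_vec (conn_form y Y v)" if "y \<in> U" for y
    using induced_connection_hol_vec[OF smooth_on_const[OF open_domain] refl that, of Y v] by simp
qed

lemma induced_curvature_const:
  assumes x: "x \<in> U"
  shows "dz l (induced_curvature (levi_civita U g) (\<lambda>_. X) (\<lambda>_. Y) (\<lambda>_. hol_vec v) x) =
    cvec_derivative X (\<lambda>y. conn_form y Y v $ l) x - cvec_derivative Y (\<lambda>y. conn_form y X v $ l) x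
    + (conn_form x X (conn_form x Y v) $ l - conn_form x Y (conn_form x X v) $ l)"
proof -
  have bracket: "complexify_op lie_bracket (\<lambda>_. X) (\<lambda>_. Y) = (\<lambda>_. 0)"
    by (rule ext) (simp add: complexify_op_def lie_bracket_def lie_derivative_def comp_def zero_prod_def)
  have "conn_form x 0 v = 0"
    by (simp add: conn_form_def complex_part_def bilinear_lzero[OF \<Gamma>_bilinear[OF x]])
  then have "induced_connection (levi_civita U g) (\<lambda>_. 0) (\<lambda>_. hol_vec v) x = hol_vec 0"
    using induced_connection_hol_vec[OF smooth_on_const[OF open_domain] refl x, of 0 v] 
    by (simp add: zero_vec_def)
  then show ?thesis
    unfolding induced_curvature_def bracket induced_connection_const_twice[OF x]
    by (simp add: dz_diff dz_hol_vec)
qed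

text \<open>
The curvature matrix is \<open>d\<theta> + \<theta> \<and> \<theta>\<close> for the connection matrix \<open>\<theta>\<close>. The trace of the quadratic
term is that of a commutator and vanishes, so that only the differential of the trace of \<open>\<theta>\<close>
remains.
\<close>

lemma trace_induced_curvature:
  assumes x: "x \<in> U"
  shows "(\<Sum>k\<in>UNIV. dz k (induced_curvature (levi_civita U g) (\<lambda>_. X) (\<lambda>_. Y) (\<lambda>_. d_z k) x)) =
    cvec_derivative X (conn_trace Y) x - cvec_derivative Y (conn_trace X) x"
proof -
  have deriv: "cvec_derivative X (conn_trace Y) x =
      (\<Sum>k\<in>UNIV. cvec_derivative X (\<lambda>y. conn_form y Y (axis k 1) $ k) x)" for X Y
  proof -
    have "((\<lambda>y. conn_form y Y (axis k 1) $ k) has_derivative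
        frechet_derivative (\<lambda>y. conn_form y Y (axis k 1) $ k) (at x)) (at x)" for k
      by (intro smooth_on_has_derivative[OF open_domain _ x] smooth_intros smooth_on_conn_form open_domain)
    then have "(conn_trace Y has_derivative
        (\<lambda>v. \<Sum>k\<in>UNIV. frechet_derivative (\<lambda>y. conn_form y Y (axis k 1) $ k) (at x) v)) (at x)"
      unfolding conn_trace_eq[abs_def] by (intro has_derivative_sum)
    then show ?thesis
      by (simp add: cvec_derivative_def frechet_derivative_at[symmetric] sum.distrib sum_distrib_left)
  qed
  have "(\<Sum>k\<in>UNIV. conn_form x X (conn_form x Y (axis k 1)) $ k) =
      (\<Sum>k\<in>UNIV. conn_form x Y (conn_form x X (axis k 1)) $ k)"
    by (rule trace_product_commute) (simp_all add: conn_form_add[OF x] conn_form_scale[OF x])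
  then show ?thesis
    unfolding d_z_eq_hol_vec induced_curvature_const[OF x] deriv by (simp add: sum.distrib sum_subtractf)
qed

end

lemma matrix_mul_matrix_inv:
  fixes H :: "'a::semiring_1 ^ 'n ^ 'n::finite"
  assumes "invertible H" shows "H ** matrix_inv H = mat 1"
  using someI_ex[OF assms[unfolded invertible_def]] by (simp add: matrix_inv_def)

text \<open>
Lowering an index of the curvature and contracting with the inverse metric cancel each other, so
the Ricci form is the trace of the curvature over its endomorphism indices.
\<close>

lemma first_lc_ricci_form_eq:
  fixes h :: "('m, 'n::finite) form11"
  assumes "complex_christoffel (chart_image c) (riemannian_metric (h c)) \<Gamma>"
    and x: "x \<in> chart_image c" and inv: "invertible (h c x)"
  shows "first_lc_ricci_form h c x $ i $ j =
    cvec_derivative (d_z i) (complex_christoffel.conn_trace \<Gamma> (d_zbar j)) x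
    - cvec_derivative (d_zbar j) (complex_christoffel.conn_trace \<Gamma> (d_z i)) x"
proof -
  interpret complex_christoffel "chart_image c" "riemannian_metric (h c)" \<Gamma> by fact
  let ?R = "\<lambda>k s. lc_curvature_up (chart_image c) (h c) x i j k s"
  have delta: "(\<Sum>l\<in>UNIV. h c x $ s $ l * h_up (h c x) k l) = (if s = k then 1 else 0)" for k s
  proof -
    have "(\<Sum>l\<in>UNIV. h c x $ s $ l * h_up (h c x) k l) = (h c x ** matrix_inv (h c x)) $ s $ k"
      by (simp add: matrix_matrix_mult_def h_up_def)
    then show ?thesis by (simp add: matrix_mul_matrix_inv[OF inv] mat_def)
  qed
  have "first_lc_ricci_form h c x $ i $ j =
      (\<Sum>k\<in>UNIV. \<Sum>l\<in>UNIV. \<Sum>s\<in>UNIV. ?R k s * (h c x $ s $ l * h_up (h c x) k l))"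
    by (simp add: first_lc_ricci_form_def lc_curvature_def sum_distrib_left mult_ac)
  also have "\<dots> = (\<Sum>k\<in>UNIV. \<Sum>s\<in>UNIV. ?R k s * (\<Sum>l\<in>UNIV. h c x $ s $ l * h_up (h c x) k l))"
    unfolding sum_distrib_left by (intro sum.cong refl sum.swap)
  also have "\<dots> = (\<Sum>k\<in>UNIV. ?R k k)"
    by (simp add: delta if_distrib cong: if_cong)
  finally show ?thesis
    unfolding lc_curvature_up_def trace_induced_curvature[OF x] .
qed

section \<open>Metrics conformal to a rank-one perturbation of the Euclidean metric\<close>

text \<open>
The real part of the form \<open>\<lambda>u. hprod u z\<close> is half the differential of \<open>(norm z)\<^sup>2\<close> at \<open>z\<close>. All derivatives
of the metrics below are expressed through this form.
\<close>

definition hprod :: "complex ^ 'n \<Rightarrow> complex ^ 'n::finite \<Rightarrow> complex" where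
  "hprod u v = (\<Sum>i\<in>UNIV. u $ i * cnj (v $ i))"

lemma hprod_simps [simp]:
  "hprod (u + u') v = hprod u v + hprod u' v" "hprod u (v + v') = hprod u v + hprod u v'"
  "hprod (- u) v = - hprod u v" "hprod u (- v) = - hprod u v"
  "hprod (c *s u) v = c * hprod u v" "hprod u (c *s v) = cnj c * hprod u v"
  "hprod (t *\<^sub>R u) v = of_real t * hprod u v" "hprod u (t *\<^sub>R v) = of_real t * hprod u v"
  "hprod (cplx_J u) v = \<i> * hprod u v" "hprod u (cplx_J v) = - \<i> * hprod u v"
  by (simp_all add: hprod_def sum.distrib sum_negf sum_distrib_left algebra_simps scaleR_conv_of_real[where 'a = complex])

lemma cnj_hprod: "cnj (hprod u v) = hprod v u"
  by (simp add: hprod_def mult.commute)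

lemma Re_hprod: "Re (hprod u v) = u \<bullet> v"
  by (simp add: hprod_def inner_vec_def inner_complex_def)

lemma Re_mult_cnj: "Re (w * cnj w) = (norm w)\<^sup>2"
  by (simp add: cmod_power2 flip: power2_eq_square)

lemma hprod_self: "hprod u u = of_real ((norm u)\<^sup>2)"
proof -
  have "Im (hprod u u) = 0" using cnj_hprod[of u u] by (simp add: complex_eq_iff)
  then show ?thesis by (simp add: complex_eq_iff Re_hprod power2_norm_eq_inner)
qed

lemma hprod_axis: "hprod (axis k 1) v = cnj (v $ k)"
proof -
  have "axis k 1 $ i * cnj (v $ i) = (if i = k then cnj (v $ i) else 0)" for i by (simp add: axis_def)
  then show ?thesis by (simp add: hprod_def)
qed

lemma bounded_bilinear_hprod: "bounded_bilinear (hprod :: complex ^ 'n::finite \<Rightarrow> _)"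
  by (rule bilinear_conv_bounded_bilinear[THEN iffD1])
    (simp add: bilinear_def linear_iff scaleR_conv_of_real[where 'a = complex])

lemma bounded_bilinear_complex_scale: "bounded_bilinear ((*s) :: complex \<Rightarrow> complex ^ 'n::finite \<Rightarrow> _)"
  by (rule bilinear_conv_bounded_bilinear[THEN iffD1])
    (simp add: bilinear_def linear_iff vec_eq_iff algebra_simps)

lemmas smooth_on_hprod [smooth_intros] = smooth_on_bilinear[OF bounded_bilinear_hprod]
lemmas smooth_on_complex_scale [smooth_intros] = smooth_on_bilinear[OF bounded_bilinear_complex_scale]
lemmas has_derivative_hprod = bounded_bilinear.FDERIV[OF bounded_bilinear_hprod]

definition \<rho> :: "complex ^ 'n::finite \<Rightarrow> real" where
  "\<rho> z = inverse ((norm z)\<^sup>2)"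

lemma smooth_on_\<rho> [smooth_intros]:
  fixes U :: "(complex ^ 'n::finite) set"
  assumes "open U" "0 \<notin> U" shows "smooth_on U \<rho>"
proof -
  have "smooth_on U (\<lambda>z :: complex ^ 'n. inverse (z \<bullet> z))"
    using assms by (intro smooth_intros) auto
  then show ?thesis by (simp add: \<rho>_def[abs_def] power2_norm_eq_inner)
qed

lemma has_derivative_\<rho>:
  assumes "z \<noteq> 0"
  shows "(\<rho> has_derivative (\<lambda>w. - 2 * (z \<bullet> w) * (\<rho> z)\<^sup>2)) (at z)"
proof -
  have "((\<lambda>z. inverse (z \<bullet> z)) has_derivative (\<lambda>w. - 2 * (z \<bullet> w) * (\<rho> z)\<^sup>2)) (at z)"
    using assms by (auto intro!: derivative_eq_intros
        simp: \<rho>_def power2_norm_eq_inner power2_eq_square[of "inverse _"] inner_commute algebra_simps)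
  then show ?thesis by (simp add: \<rho>_def[abs_def] power2_norm_eq_inner)
qed

lemma \<rho>_hprod_self: "of_real (\<rho> z) * (of_real (\<rho> z) * hprod z z) = of_real (\<rho> z)"
  "z \<noteq> 0 \<Longrightarrow> of_real (\<rho> z) * hprod z z = 1"
  by (cases "z = 0"; simp add: \<rho>_def hprod_self power2_eq_square field_simps)+

text \<open>
With \<open>r = (norm z)\<^sup>2\<close> this is the matrix \<open>(4a/r) (1 + \<kappa> P)\<close>, where \<open>P\<close> is the orthogonal projection
to a line determined by \<open>z\<close>. The canonical metric is the case \<open>a = 1\<close>, \<open>\<kappa> = 0\<close>; subtracting from it
a multiple of its Ricci form changes \<open>a\<close> and \<open>\<kappa>\<close> only. The connection does not see the constant
factor \<open>a\<close>, which is why it is kept separate from \<open>\<kappa>\<close>.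
\<close>

definition hopf_family :: "real \<Rightarrow> real \<Rightarrow> complex ^ 'n::finite \<Rightarrow> complex ^ 'n ^ 'n" where
  "hopf_family a \<kappa> z =
     (\<chi> i j. of_real (4 * a * \<rho> z) * ((if i = j then 1 else 0) + of_real (\<kappa> * \<rho> z) * cnj (z $ i) * z $ j))"

lemma hopf_family_form:
  "(\<Sum>i\<in>UNIV. \<Sum>j\<in>UNIV. hopf_family a \<kappa> z $ i $ j * u $ i * cnj (v $ j)) =
    of_real (4 * a * \<rho> z) * (hprod u v + of_real (\<kappa> * \<rho> z) * (hprod u z * cnj (hprod v z)))"
proof -
  have "hopf_family a \<kappa> z $ i $ j * u $ i * cnj (v $ j) = of_real (4 * a * \<rho> z) *
      ((if i = j then u $ i * cnj (v $ j) else 0) + of_real (\<kappa> * \<rho> z) * ((u $ i * cnj (z $ i)) * cnj (v $ j * cnj (z $ j))))"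
    for i j by (simp add: hopf_family_def algebra_simps)
  then show ?thesis
    by (simp only: sum_distrib_left[symmetric] sum_distrib_right[symmetric] sum.distrib hprod_def cnj_sum)
       (simp add: sum_distrib_left[symmetric] sum_distrib_right[symmetric])
qed

lemma riemannian_metric_hopf_family:
  "riemannian_metric (hopf_family a \<kappa>) z u v =
    8 * a * \<rho> z * (Re (hprod u v) + \<kappa> * \<rho> z * Re (hprod u z * cnj (hprod v z)))"
  unfolding riemannian_metric_def hopf_family_form by (simp add: algebra_simps)

text \<open>
Since \<open>P\<close> is idempotent, \<open>1 - (\<kappa> / (1 + \<kappa>)) P\<close> is the inverse of \<open>1 + \<kappa> P\<close>.
\<close>

lemma invertible_hopf_family:
  assumes "a > 0" "\<kappa> \<ge> 0" "z \<noteq> 0"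
  shows "invertible (hopf_family a \<kappa> z)"
proof -
  define r where "r = (norm z)\<^sup>2"
  have r: "r > 0" "\<rho> z = 1 / r" using assms(3) by (simp_all add: r_def \<rho>_def inverse_eq_divide)
  define B :: "complex ^ 'a ^ 'a" where
    "B = (\<chi> i j. of_real (r / (4 * a)) * ((if i = j then 1 else 0) - of_real (\<kappa> / ((1 + \<kappa>) * r)) * cnj (z $ i) * z $ j))"
  have "(\<Sum>k\<in>UNIV. hopf_family a \<kappa> z $ i $ k * B $ k $ j) = (if i = j then 1 else 0)" for i j
  proof -
    define \<delta> :: "'a \<Rightarrow> 'a \<Rightarrow> complex" where "\<delta> i j = (if i = j then 1 else 0)" for i j
    define p q :: complex where "p = of_real (\<kappa> / r)" and "q = of_real (\<kappa> / ((1 + \<kappa>) * r))"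
    define s s' :: complex where "s = of_real (4 * a / r)" and "s' = of_real (r / (4 * a))"
    have ab: "s * s' = 1"
      using assms(1) r by (simp add: s_def s'_def field_simps)
    have entries: "hopf_family a \<kappa> z $ i $ k = s * (\<delta> i k + p * cnj (z $ i) * z $ k)"
      "B $ k $ j = s' * (\<delta> k j - q * cnj (z $ k) * z $ j)" for i k j
      by (simp_all add: B_def hopf_family_def r(2) \<delta>_def p_def q_def s_def s'_def)
    have "hopf_family a \<kappa> z $ i $ k * B $ k $ j = (s * s') *
        (\<delta> i k * \<delta> k j - \<delta> i k * (q * cnj (z $ k) * z $ j) + p * cnj (z $ i) * z $ k * \<delta> k j
         - p * q * cnj (z $ i) * z $ j * (z $ k * cnj (z $ k)))" for k
      unfolding entries by (simp add: algebra_simps)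
    then have "(\<Sum>k\<in>UNIV. hopf_family a \<kappa> z $ i $ k * B $ k $ j) =
        (\<Sum>k\<in>UNIV. \<delta> i k * \<delta> k j) - (\<Sum>k\<in>UNIV. \<delta> i k * (q * cnj (z $ k) * z $ j))
        + (\<Sum>k\<in>UNIV. p * cnj (z $ i) * z $ k * \<delta> k j) - p * q * cnj (z $ i) * z $ j * hprod z z"
      unfolding ab by (simp add: sum.distrib sum_subtractf sum_distrib_left hprod_def)
    also have "\<dots> = \<delta> i j + (p - q - p * q * hprod z z) * (cnj (z $ i) * z $ j)"
    proof -
      have \<delta>: "\<delta> i k * x = (if i = k then x else 0)" "x * \<delta> k j = (if k = j then x else 0)" for k x
        by (simp_all add: \<delta>_def)
      have "(\<Sum>k\<in>UNIV. \<delta> i k * \<delta> k j) = \<delta> i j"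
        "(\<Sum>k\<in>UNIV. \<delta> i k * (q * cnj (z $ k) * z $ j)) = q * cnj (z $ i) * z $ j"
        "(\<Sum>k\<in>UNIV. p * cnj (z $ i) * z $ k * \<delta> k j) = p * cnj (z $ i) * z $ j"
        unfolding \<delta> by simp_all
      then show ?thesis by (simp only:) (simp add: algebra_simps)
    qed
    also have "p - q - p * q * hprod z z = of_real (\<kappa> / r - \<kappa> / ((1 + \<kappa>) * r) - \<kappa> / r * (\<kappa> / ((1 + \<kappa>) * r)) * r)"
      by (simp add: p_def q_def hprod_self r_def)
    also have "\<kappa> / r - \<kappa> / ((1 + \<kappa>) * r) - \<kappa> / r * (\<kappa> / ((1 + \<kappa>) * r)) * r = 0"
      using r assms(2) by (simp add: divide_simps add_nonneg_eq_0_iff) (simp add: algebra_simps)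
    finally show ?thesis by (simp add: \<delta>_def)
  qed
  then have "hopf_family a \<kappa> z ** B = mat 1"
    by (simp add: matrix_matrix_mult_def mat_def vec_eq_iff)
  then show ?thesis
    using invertible_right_inverse by blast
qed

section \<open>Their Christoffel symbols\<close>

text \<open>
Solving the Koszul formula for the metric with parameters \<open>a\<close> and \<open>\<kappa>\<close> gives symbols of the shape
\<open>\<alpha>(u) v + \<alpha>(v) u + \<gamma>(u, v) z\<close>. With \<open>s u = hprod u z\<close> the coefficients are
\<open>\<alpha>(u) = (\<i> \<kappa> Im (s u) - Re (s u)) / r\<close> and
\<open>\<gamma>(u, v) = Re (hprod u v) / r - \<i> \<kappa> (Im (s u) s v + Im (s v) s u) / r\<^sup>2\<close>. For \<open>\<kappa> = 0\<close> these are the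
familiar symbols of a conformally flat metric.
\<close>

definition hopf_weight :: "real \<Rightarrow> complex ^ 'n::finite \<Rightarrow> complex ^ 'n \<Rightarrow> complex" where
  "hopf_weight \<kappa> z u = of_real (\<rho> z) * (\<i> * of_real (\<kappa> * Im (hprod u z)) - of_real (Re (hprod u z)))"

definition hopf_radial :: "real \<Rightarrow> complex ^ 'n::finite \<Rightarrow> complex ^ 'n \<Rightarrow> complex ^ 'n \<Rightarrow> complex" where
  "hopf_radial \<kappa> z u v = of_real (\<rho> z * Re (hprod u v))
     - \<i> * of_real (\<kappa> * \<rho> z * \<rho> z) *
       (of_real (Im (hprod u z)) * hprod v z + of_real (Im (hprod v z)) * hprod u z)"

definition hopf_christoffel ::
  "real \<Rightarrow> complex ^ 'n::finite \<Rightarrow> complex ^ 'n \<Rightarrow> complex ^ 'n \<Rightarrow> complex ^ 'n" where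
  "hopf_christoffel \<kappa> z u v =
     hopf_weight \<kappa> z u *s v + hopf_weight \<kappa> z v *s u + hopf_radial \<kappa> z u v *s z"

lemma hopf_weight_add: "hopf_weight \<kappa> z (u + v) = hopf_weight \<kappa> z u + hopf_weight \<kappa> z v"
  and hopf_weight_scaleR: "hopf_weight \<kappa> z (t *\<^sub>R u) = of_real t * hopf_weight \<kappa> z u"
  by (simp_all add: hopf_weight_def algebra_simps)

lemma hopf_radial_add: "hopf_radial \<kappa> z u (v + v') = hopf_radial \<kappa> z u v + hopf_radial \<kappa> z u v'"
  and hopf_radial_scaleR: "hopf_radial \<kappa> z u (t *\<^sub>R v) = of_real t * hopf_radial \<kappa> z u v"
  by (simp_all add: hopf_radial_def algebra_simps)

lemma hopf_radial_sym: "hopf_radial \<kappa> z u v = hopf_radial \<kappa> z v u"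
  by (simp add: hopf_radial_def Re_hprod inner_commute algebra_simps)

lemma hopf_christoffel_sym: "hopf_christoffel \<kappa> z u v = hopf_christoffel \<kappa> z v u"
  by (simp add: hopf_christoffel_def hopf_radial_sym[of \<kappa> z u v] add.commute)

lemma bilinear_hopf_christoffel: "bilinear (hopf_christoffel \<kappa> z)"
proof -
  have "linear (hopf_christoffel \<kappa> z u)" for u
    by (rule linearI)
      (simp_all add: hopf_christoffel_def hopf_weight_add hopf_weight_scaleR hopf_radial_add hopf_radial_scaleR
        vec_eq_iff scaleR_conv_of_real[where 'a = complex] algebra_simps)
  then show ?thesis
    unfolding bilinear_def using hopf_christoffel_sym[of \<kappa> z] by (metis ext)
qed

lemma smooth_on_hopf_christoffel:
  assumes "open U" "0 \<notin> U" "smooth_on U X" "smooth_on U Y"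
  shows "smooth_on U (\<lambda>z. hopf_christoffel \<kappa> z (X z) (Y z))"
  unfolding hopf_christoffel_def hopf_weight_def hopf_radial_def
  using assms by (intro smooth_intros)

text \<open>
The metric condition for constant fields \<open>u\<close>, \<open>v\<close>: the right-hand side is the derivative of
\<open>\<rho> z * g u v\<close> in direction \<open>w\<close>, divided by \<open>\<rho> z\<close>. After the relation \<open>\<rho> z * hprod z z = 1\<close> has been
used for the component of the symbols along \<open>z\<close>, what is left is a polynomial identity in the real
and imaginary parts of the six products of \<open>u\<close>, \<open>v\<close>, \<open>w\<close> and \<open>z\<close>.
\<close>

lemma hopf_christoffel_compatible:
  fixes \<kappa> :: real and z u v w :: "complex ^ 'n::finite"
  assumes z: "z \<noteq> 0"
  defines "g \<equiv> \<lambda>u v. Re (hprod u v) + \<kappa> * \<rho> z * Re (hprod u z * cnj (hprod v z))"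
  shows "g (hopf_christoffel \<kappa> z w u) v + g u (hopf_christoffel \<kappa> z w v) =
    - 2 * \<rho> z * Re (hprod w z) * (Re (hprod u v) + 2 * \<kappa> * \<rho> z * Re (hprod u z * cnj (hprod v z)))
    + \<kappa> * \<rho> z * Re (hprod u w * cnj (hprod v z) + hprod u z * cnj (hprod v w))"
proof -
  obtain w1 w2 u1 u2 v1 v2 where S: "hprod w z = Complex w1 w2" "hprod u z = Complex u1 u2" "hprod v z = Complex v1 v2"
    by (metis complex.exhaust)
  obtain p1 p2 q1 q2 m1 m2 where H: "hprod u v = Complex m1 m2" "hprod w u = Complex p1 p2" "hprod w v = Complex q1 q2"
    by (metis complex.exhaust)
  have S': "hprod z w = Complex w1 (- w2)" "hprod z u = Complex u1 (- u2)" "hprod z v = Complex v1 (- v2)"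
    "hprod v u = Complex m1 (- m2)" "hprod u w = Complex p1 (- p2)" "hprod v w = Complex q1 (- q2)"
    by (simp_all add: complex_eq_iff S H cnj_hprod[of w z, symmetric] cnj_hprod[of u z, symmetric] cnj_hprod[of v z, symmetric]
        cnj_hprod[of u v, symmetric] cnj_hprod[of w u, symmetric] cnj_hprod[of w v, symmetric])
  define t where "t = \<rho> z"
  \<comment> \<open>\<open>R\<close> is the radial coefficient freed of one factor \<open>\<rho> z\<close>, which pairing \<open>z\<close> with itself absorbs.\<close>
  define R where "R x = of_real (Re (hprod w x)) - \<i> * of_real (\<kappa> * t) *
      (of_real (Im (hprod w z)) * hprod x z + of_real (Im (hprod x z)) * hprod w z)" for x
  have rad1: "hopf_radial \<kappa> z w x = of_real t * R x" and rad2: "hopf_radial \<kappa> z w x * hprod z z = R x" for x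
  proof -
    show *: "hopf_radial \<kappa> z w x = of_real t * R x"
      by (simp add: hopf_radial_def R_def t_def algebra_simps)
    have "hopf_radial \<kappa> z w x * hprod z z = R x * (of_real t * hprod z z)"
      unfolding * by algebra
    then show "hopf_radial \<kappa> z w x * hprod z z = R x"
      unfolding t_def \<rho>_hprod_self(2)[OF z] by simp
  qed
  have pair: "hprod (hopf_christoffel \<kappa> z w x) y =
      hopf_weight \<kappa> z w * hprod x y + hopf_weight \<kappa> z x * hprod w y + of_real t * R x * hprod z y"
    "hprod (hopf_christoffel \<kappa> z w x) z = hopf_weight \<kappa> z w * hprod x z + hopf_weight \<kappa> z x * hprod w z + R x"
    for x y
    by (simp_all only: hopf_christoffel_def hprod_simps rad2) (simp only: rad1)
  have pair': "hprod y (hopf_christoffel \<kappa> z w x) = cnj (hprod (hopf_christoffel \<kappa> z w x) y)" for x y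
    by (rule cnj_hprod[symmetric])
  show ?thesis
    unfolding g_def pair' pair(2) unfolding pair(1) R_def hopf_weight_def t_def[symmetric]
    by (simp add: S S' H algebra_simps)
qed

lemma complex_christoffel_hopf_family:
  assumes "open U" "0 \<notin> U" and h: "\<And>z. z \<in> U \<Longrightarrow> h z = hopf_family a \<kappa> z" and "a > 0" "\<kappa> \<ge> 0"
  shows "complex_christoffel U (riemannian_metric h) (hopf_christoffel \<kappa>)"
proof -
  let ?g = "\<lambda>z u v. 8 * a * \<rho> z * (Re (hprod u v) + \<kappa> * \<rho> z * Re (hprod u z * cnj (hprod v z)))"
  have g: "riemannian_metric h z u v = ?g z u v" if "z \<in> U" for z u v
    using riemannian_metric_hopf_family[of a \<kappa> z u v] h[OF that] by (simp add: riemannian_metric_def)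
  have ne: "z \<noteq> 0" if "z \<in> U" for z using that assms(2) by auto
  show ?thesis
  proof (unfold_locales, goal_cases)
    case 1 show ?case by fact
  next
    case (2 z)
    then show ?case
      by (simp add: g bilinear_def linear_iff algebra_simps)
  next
    case (3 z u v)
    then show ?case
      by (simp add: g Re_hprod inner_commute algebra_simps)
  next
    case (4 z u)
    have "\<rho> z > 0" using ne[OF 4(1)] by (simp add: \<rho>_def)
    moreover have "?g z u u = 0" using 4 g by metis
    ultimately have "(norm u)\<^sup>2 + \<kappa> * \<rho> z * (norm (hprod u z))\<^sup>2 = 0"
      using \<open>a > 0\<close> unfolding Re_mult_cnj by (simp add: hprod_self)
    moreover have "\<kappa> * \<rho> z * (norm (hprod u z))\<^sup>2 \<ge> 0"
      using \<open>\<rho> z > 0\<close> \<open>\<kappa> \<ge> 0\<close> by simp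
    ultimately have "(norm u)\<^sup>2 \<le> 0" by linarith
    then show ?case by simp
  next
    case 5 show ?case by (rule bilinear_hopf_christoffel)
  next
    case 6 show ?case by (rule hopf_christoffel_sym)
  next
    case (7 X Y) then show ?case by (rule smooth_on_hopf_christoffel[OF assms(1,2)])
  next
    case (8 z X X' Y Y')
    note z = ne[OF 8(1)]
    have "((\<lambda>y. ?g y (X y) (Y y)) has_derivative
        (\<lambda>w. riemannian_metric h z (X' w + hopf_christoffel \<kappa> z w (X z)) (Y z) +
          riemannian_metric h z (X z) (Y' w + hopf_christoffel \<kappa> z w (Y z)))) (at z)"
    proof -
      define G where "G u v = Re (hprod u v) + \<kappa> * \<rho> z * Re (hprod u z * cnj (hprod v z))" for u v
      have G: "riemannian_metric h z u v = 8 * a * \<rho> z * G u v" for u v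
        by (simp add: g[OF 8(1)] G_def)
      have G_add: "G (u + u') v = G u v + G u' v" "G u (v + v') = G u v + G u v'" for u u' v v'
        by (simp_all add: G_def algebra_simps)
      note compat = hopf_christoffel_compatible[OF z, of \<kappa>, folded G_def]
      have "(\<lambda>w. riemannian_metric h z (X' w + hopf_christoffel \<kappa> z w (X z)) (Y z) +
          riemannian_metric h z (X z) (Y' w + hopf_christoffel \<kappa> z w (Y z))) =
        (\<lambda>w. 8 * a * \<rho> z * (G (X' w) (Y z) + G (X z) (Y' w) +
          (G (hopf_christoffel \<kappa> z w (X z)) (Y z) + G (X z) (hopf_christoffel \<kappa> z w (Y z)))))"
        by (simp add: G G_add algebra_simps)
      moreover have "((\<lambda>y. ?g y (X y) (Y y)) has_derivative (\<lambda>w. 8 * a * \<rho> z * (G (X' w) (Y z) + G (X z) (Y' w) +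
          (G (hopf_christoffel \<kappa> z w (X z)) (Y z) + G (X z) (hopf_christoffel \<kappa> z w (Y z)))))) (at z)"
        unfolding compat
        by (rule derivative_eq_intros has_derivative_hprod has_derivative_\<rho>[OF z] 8 refl
            bounded_linear.has_derivative[OF bounded_linear_Re] bounded_linear.has_derivative[OF bounded_linear_cnj])+
          (simp add: G_def fun_eq_iff algebra_simps power2_eq_square Re_hprod inner_commute)
      ultimately show ?thesis by simp
    qed
    then show ?case
      by (rule has_derivative_cong_open[OF assms(1) 8(1), THEN iffD2, rotated]) (simp add: g)
  qed
qed

section \<open>The first Levi-Civita Ricci form of these metrics\<close>

text \<open>
Taking \<open>\<complex>\<close>-linear parts halves \<open>hprod v z\<close> where the symbols contain its real part, multiplies it
by \<open>- \<i>/2\<close> where they contain its imaginary part, and leaves \<open>hprod v u / 2\<close> of \<open>Re (hprod u v)\<close>.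
\<close>

lemma complex_part_hopf_christoffel:
  "complex_part (hopf_christoffel \<kappa> z u) v = hopf_weight \<kappa> z u *s v + (of_real (\<rho> z * (\<kappa> - 1) / 2) * hprod v z) *s u
    + (of_real (\<rho> z / 2) * hprod v u - \<i> * of_real (\<kappa> * \<rho> z * \<rho> z) *
        ((of_real (Im (hprod u z)) - \<i> / 2 * hprod u z) * hprod v z)) *s z"
proof -
  have w: "hopf_weight \<kappa> z v - \<i> * hopf_weight \<kappa> z (cplx_J v) = of_real (\<rho> z * (\<kappa> - 1)) * hprod v z"
    by (simp add: hopf_weight_def complex_eq_iff algebra_simps)
  have r: "hopf_radial \<kappa> z u v - \<i> * hopf_radial \<kappa> z u (cplx_J v) =
      of_real (\<rho> z) * hprod v u - \<i> * of_real (\<kappa> * \<rho> z * \<rho> z) *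
        ((2 * of_real (Im (hprod u z)) - \<i> * hprod u z) * hprod v z)"
    by (simp add: hopf_radial_def complex_eq_iff algebra_simps flip: cnj_hprod[of u v])
  have "complex_part (hopf_christoffel \<kappa> z u) v = hopf_weight \<kappa> z u *s v
      + ((hopf_weight \<kappa> z v - \<i> * hopf_weight \<kappa> z (cplx_J v)) / 2) *s u
      + ((hopf_radial \<kappa> z u v - \<i> * hopf_radial \<kappa> z u (cplx_J v)) / 2) *s z"
    by (simp add: complex_part_def hopf_christoffel_def vec_eq_iff scaleR_conv_of_real[where 'a = complex] field_simps)
  then show ?thesis
    unfolding w r by (simp add: vec_eq_iff field_simps)
qed

text \<open>
The trace of the map \<open>v \<mapsto> \<phi>(v) y\<close> is \<open>\<phi>(y)\<close>, so each summand of the \<open>\<complex>\<close>-linear part contributes one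
scalar. The real part of the trace is \<open>- CARD('n) / 2\<close> times the differential of \<open>ln ((norm z)\<^sup>2)\<close> and
hence closed; only the imaginary part, with its factor \<open>1 + \<kappa> - CARD('n) * \<kappa>\<close>, produces curvature.
\<close>

lemma complex_trace_hopf_christoffel:
  fixes \<kappa> :: real and z :: "complex ^ 'n::finite"
  shows "complex_trace (hopf_christoffel \<kappa> z u) =
    - of_real (\<rho> z) * (of_real (CARD('n) * Re (hprod u z)) +
      \<i> * of_real ((1 + \<kappa> - CARD('n) * \<kappa>) * Im (hprod u z)))"
proof -
  have "complex_trace (hopf_christoffel \<kappa> z u) =
      of_nat CARD('n) * hopf_weight \<kappa> z u + of_real (\<rho> z * (\<kappa> - 1) / 2) * hprod u z + of_real (\<rho> z / 2) * hprod z u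
      - \<i> * of_real (\<kappa> * \<rho> z * \<rho> z) * ((of_real (Im (hprod u z)) - \<i> / 2 * hprod u z) * hprod z z)"
  proof -
    define W c1 c2 c3 where "W = hopf_weight \<kappa> z u" and "c1 = (of_real (\<rho> z * (\<kappa> - 1) / 2) :: complex)"
      and "c2 = (of_real (\<rho> z / 2) :: complex)"
      and "c3 = \<i> * of_real (\<kappa> * \<rho> z * \<rho> z) * (of_real (Im (hprod u z)) - \<i> / 2 * hprod u z)"
    have "complex_part (hopf_christoffel \<kappa> z u) (axis k 1) $ k =
        W + c1 * (u $ k * cnj (z $ k)) + c2 * (z $ k * cnj (u $ k)) - c3 * (z $ k * cnj (z $ k))" for k
      unfolding complex_part_hopf_christoffel hprod_axis W_def[symmetric] c1_def[symmetric] c2_def[symmetric]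
        mult.assoc[symmetric, of "\<i> * _"] c3_def[symmetric]
      by (simp add: axis_nth algebra_simps)
    then have "complex_trace (hopf_christoffel \<kappa> z u) =
        of_nat CARD('n) * W + c1 * hprod u z + c2 * hprod z u - c3 * hprod z z"
      by (simp add: complex_trace_def hprod_def sum.distrib sum_subtractf sum_distrib_left)
    then show ?thesis by (simp only: W_def c1_def c2_def c3_def mult.assoc)
  qed
  also have "\<dots> = of_nat CARD('n) * hopf_weight \<kappa> z u + of_real (\<rho> z * (\<kappa> - 1) / 2) * hprod u z + of_real (\<rho> z / 2) * hprod z u
      - \<i> * of_real \<kappa> * (of_real (Im (hprod u z)) - \<i> / 2 * hprod u z) * (of_real (\<rho> z) * (of_real (\<rho> z) * hprod z z))"
    by (simp add: algebra_simps)
  also have "\<dots> = - of_real (\<rho> z) * (of_real (CARD('n) * Re (hprod u z)) +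
      \<i> * of_real ((1 + \<kappa> - CARD('n) * \<kappa>) * Im (hprod u z)))"
    unfolding \<rho>_hprod_self(1) cnj_hprod[symmetric, of z u]
    by (simp add: hopf_weight_def complex_eq_iff field_simps)
  finally show ?thesis .
qed

text \<open>
Without the constant \<open>C\<close>, both derivatives are the coefficient of \<open>\<partial>\<^sub>i\<partial>\<^sub>j ln ((norm z)\<^sup>2)\<close>, the second
index being barred: the functions that are differentiated are its first derivatives.
\<close>

lemma cvec_derivative_\<rho>_component:
  fixes z :: "complex ^ 'n::finite"
  assumes z: "z \<noteq> 0"
  shows "cvec_derivative (d_z i) (\<lambda>z. C * of_real (\<rho> z) * z $ j) z =
      C * (of_real (\<rho> z) * (if i = j then 1 else 0) - of_real ((\<rho> z)\<^sup>2) * cnj (z $ i) * z $ j)"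
    and "cvec_derivative (d_zbar j) (\<lambda>z. C * of_real (\<rho> z) * cnj (z $ i)) z =
      C * (of_real (\<rho> z) * (if i = j then 1 else 0) - of_real ((\<rho> z)\<^sup>2) * cnj (z $ i) * z $ j)"
proof -
  have dot: "z \<bullet> axis k 1 = Re (z $ k)" "z \<bullet> cplx_J (axis k 1) = Im (z $ k)" for k
  proof -
    have "cplx_J (axis k 1) = axis k \<i>" by (simp add: vec_eq_iff axis_def)
    then show "z \<bullet> axis k 1 = Re (z $ k)" "z \<bullet> cplx_J (axis k 1) = Im (z $ k)"
      by (simp_all add: inner_axis inner_complex_def)
  qed
  have axis_comp: "axis i c $ j = (if i = j then c else 0)" for i j :: 'n and c :: complex
    by (simp add: axis_def)
  have d1: "((\<lambda>z. C * of_real (\<rho> z) * z $ j) has_derivative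
      (\<lambda>w. C * (of_real (\<rho> z) * w $ j - of_real (2 * (z \<bullet> w) * (\<rho> z)\<^sup>2) * z $ j))) (at z)"
    by (rule derivative_eq_intros has_derivative_\<rho>[OF z] refl
        bounded_linear.has_derivative[OF bounded_linear_vec_nth] bounded_linear.has_derivative[OF bounded_linear_of_real])+
      (simp add: fun_eq_iff algebra_simps)
  have d2: "((\<lambda>z. C * of_real (\<rho> z) * cnj (z $ i)) has_derivative
      (\<lambda>w. C * (of_real (\<rho> z) * cnj (w $ i) - of_real (2 * (z \<bullet> w) * (\<rho> z)\<^sup>2) * cnj (z $ i)))) (at z)"
    by (rule derivative_eq_intros has_derivative_\<rho>[OF z] refl bounded_linear.has_derivative[OF bounded_linear_cnj]
        bounded_linear.has_derivative[OF bounded_linear_vec_nth] bounded_linear.has_derivative[OF bounded_linear_of_real])+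
      (simp add: fun_eq_iff algebra_simps)
  have "cvec_derivative (d_z i) (\<lambda>z. C * of_real (\<rho> z) * z $ j) z =
      C * (of_real (\<rho> z) * (if i = j then 1 else 0)
        - of_real ((\<rho> z)\<^sup>2) * (of_real (Re (z $ i)) - \<i> * of_real (Im (z $ i))) * z $ j)"
    unfolding cvec_derivative_def frechet_derivative_at[OF d1, symmetric] d_z_def
    by (simp add: dot inner_minus_right axis_comp scaleR_conv_of_real[where 'a = complex] algebra_simps)
  also have "of_real (Re (z $ i)) - \<i> * of_real (Im (z $ i)) = cnj (z $ i)"
    by (simp add: complex_eq_iff)
  finally show "cvec_derivative (d_z i) (\<lambda>z. C * of_real (\<rho> z) * z $ j) z =
      C * (of_real (\<rho> z) * (if i = j then 1 else 0) - of_real ((\<rho> z)\<^sup>2) * cnj (z $ i) * z $ j)" .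
  have "cvec_derivative (d_zbar j) (\<lambda>z. C * of_real (\<rho> z) * cnj (z $ i)) z =
      C * (of_real (\<rho> z) * (if i = j then 1 else 0)
        - of_real ((\<rho> z)\<^sup>2) * cnj (z $ i) * (of_real (Re (z $ j)) + \<i> * of_real (Im (z $ j))))"
    unfolding cvec_derivative_def frechet_derivative_at[OF d2, symmetric] d_zbar_def
    by (simp add: dot axis_comp scaleR_conv_of_real[where 'a = complex] algebra_simps)
  also have "of_real (Re (z $ j)) + \<i> * of_real (Im (z $ j)) = z $ j"
    by (simp add: complex_eq_iff)
  finally show "cvec_derivative (d_zbar j) (\<lambda>z. C * of_real (\<rho> z) * cnj (z $ i)) z =
      C * (of_real (\<rho> z) * (if i = j then 1 else 0) - of_real ((\<rho> z)\<^sup>2) * cnj (z $ i) * z $ j)" .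
qed

text \<open>
The trace of the connection form is \<open>- (n + \<mu>) / 2\<close> times \<open>\<partial> ln r\<close> in type \<open>(1,0)\<close> and \<open>- (n - \<mu>) / 2\<close>
times its conjugate in type \<open>(0,1)\<close>, for \<open>r = (norm z)\<^sup>2\<close>, the complex dimension \<open>n\<close> and
\<open>\<mu> = 1 + \<kappa> - n * \<kappa>\<close>. In the differential the contributions of \<open>n\<close> cancel and those of \<open>\<mu>\<close> add up.
\<close>

lemma first_lc_ricci_form_hopf_family:
  fixes h :: "('m, 'n::finite) form11" and a \<kappa> :: real
  assumes U: "open (chart_image c)" "0 \<notin> chart_image c"
    and h: "\<And>z. z \<in> chart_image c \<Longrightarrow> h c z = hopf_family a \<kappa> z" and pos: "a > 0" "\<kappa> \<ge> 0"
    and z: "z \<in> chart_image c"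
  shows "first_lc_ricci_form h c z $ i $ j = of_real (1 + \<kappa> - CARD('n) * \<kappa>) *
    (of_real (\<rho> z) * (if i = j then 1 else 0) - of_real ((\<rho> z)\<^sup>2) * cnj (z $ i) * z $ j)"
proof -
  interpret complex_christoffel "chart_image c" "riemannian_metric (h c)" "hopf_christoffel \<kappa>"
    by (rule complex_christoffel_hopf_family[OF U h pos])
  let ?n = "of_nat CARD('n) :: complex" and ?\<mu> = "of_real (1 + \<kappa> - CARD('n) * \<kappa>) :: complex"
  have z0: "z \<noteq> 0" using z U(2) by auto
  have tau_z: "conn_trace (d_z i) = (\<lambda>z. - (?n + ?\<mu>) / 2 * of_real (\<rho> z) * cnj (z $ i))"
    by (rule ext) (simp add: conn_trace_def complex_trace_hopf_christoffel d_z_def hprod_axis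
        complex_eq_iff field_simps)
  have tau_zbar: "conn_trace (d_zbar j) = (\<lambda>z. - (?n - ?\<mu>) / 2 * of_real (\<rho> z) * z $ j)"
    by (rule ext) (simp add: conn_trace_def complex_trace_hopf_christoffel d_zbar_def hprod_axis
        complex_eq_iff field_simps)
  have inv: "invertible (h c z)"
    by (simp add: h[OF z] invertible_hopf_family[OF pos z0])
  show ?thesis
    unfolding first_lc_ricci_form_eq[where h = h and c = c, OF complex_christoffel_axioms z inv] tau_z tau_zbar
      cvec_derivative_\<rho>_component[OF z0]
    by (simp add: field_simps)
qed

section \<open>The Hopf manifold\<close>

text \<open>
Two points of \<open>\<complex>\<^sup>n - {0}\<close> with the same projection differ by a power of \<open>1/2\<close>, and a transition map
preserves projections. The power \<open>a\<close> found at \<open>z\<close> is the right one at all nearby points too: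
multiplication by \<open>a\<close> maps a neighbourhood of \<open>z\<close> into the open image of \<open>c'\<close>, where the projection is
injective.
\<close>

lemma transition_hopf_atlas:
  fixes c c' :: "((complex ^ 'n::finite) \<times> complex, 'n) chart"
  assumes c: "c \<in> hopf_atlas" and c': "c' \<in> hopf_atlas" and z: "z \<in> snd c ` (fst c \<inter> fst c')"
  obtains a :: real where "a > 0" "transition c c' z = a *\<^sub>R z" "a *\<^sub>R z \<in> chart_image c'"
    "(transition c c' has_derivative (\<lambda>v. a *\<^sub>R v)) (at z)"
proof -
  have sec: "hopf_proj (snd d p) = p" if "d \<in> hopf_atlas" "p \<in> fst d" for d :: "((complex ^ 'n) \<times> complex, 'n) chart" and p
    using that by (simp add: hopf_atlas_def)
  have T: "transition c c' (snd c q) = snd c' q" if "q \<in> fst c" for q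
    using that inv_into_f_f[of "snd c" "fst c" q] inj_on_inverseI[of "fst c" hopf_proj "snd c"] sec[OF c]
    by (simp add: transition_def)
  have ne: "x \<noteq> 0" if "x \<in> chart_image c \<or> x \<in> chart_image c'" for x
    using that c c' by (auto simp: hopf_atlas_def)
  obtain p where p: "p \<in> fst c" "p \<in> fst c'" "z = snd c p"
    using z by blast
  have "hopf_proj z = hopf_proj (snd c' p)"
    using p sec c c' by simp
  moreover have z_img: "z \<in> chart_image c" "snd c' p \<in> chart_image c'"
    using p by (auto simp: chart_image_def)
  ultimately obtain k :: int where k: "snd c' p = (1/2) powi k *\<^sub>R z"
    using hopf_proj_eq_iff[of z "snd c' p"] ne by auto
  define a :: real where "a = (1/2) powi k"
  \<comment> \<open>the points near \<open>z\<close> whose multiple by \<open>a\<close> still lies in the image of \<open>c'\<close>\<close>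
  define N where "N = chart_image c \<inter> (\<lambda>x. a *\<^sub>R x) -` chart_image c'"
  have "open N"
    unfolding N_def using c c'
    by (intro open_Int open_vimage continuous_intros) (auto simp: hopf_atlas_def)
  moreover have "z \<in> N"
    using z_img by (simp add: N_def a_def k)
  moreover have T_N: "transition c c' x = a *\<^sub>R x" if "x \<in> N" for x
  proof -
    have "x \<in> snd c ` fst c" "a *\<^sub>R x \<in> snd c' ` fst c'"
      using that by (simp_all add: N_def chart_image_def)
    then obtain q q' where q: "q \<in> fst c" "x = snd c q" and q': "q' \<in> fst c'" "a *\<^sub>R x = snd c' q'"
      by (elim imageE)
    have "hopf_proj x = hopf_proj (a *\<^sub>R x)"
      using that ne hopf_proj_eq_iff[of x "a *\<^sub>R x"] by (auto simp: N_def a_def)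
    then have "q = q'"
      using q q' sec c c' by metis
    then show ?thesis
      using T q q' by simp
  qed
  ultimately have "(transition c c' has_derivative (\<lambda>v. a *\<^sub>R v)) (at z)"
    using has_derivative_cong_open[of N z "transition c c'" "\<lambda>v. a *\<^sub>R v"]
      has_derivative_scaleR_right[OF has_derivative_ident, of a "at z"] by blast
  then show thesis
    using that[of a] T_N[OF \<open>z \<in> N\<close>] \<open>z \<in> N\<close> by (simp add: N_def a_def)
qed

lemma hopf_family_scaleR:
  assumes "t \<noteq> 0"
  shows "of_real (t\<^sup>2) * hopf_family a \<kappa> (t *\<^sub>R z) $ i $ j = hopf_family a \<kappa> z $ i $ j"
proof -
  define s where "s = \<rho> (t *\<^sub>R z)"
  have "\<rho> z = s * t\<^sup>2"
    using assms by (simp add: s_def \<rho>_def power_mult_distrib)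
  then show ?thesis
    unfolding hopf_family_def s_def[symmetric]
    by (simp add: s_def[symmetric] scaleR_conv_of_real[where 'a = complex] power2_eq_square algebra_simps)
qed

text \<open>
The coefficients are homogeneous of degree \<open>-2\<close>, which compensates the two Jacobian factors of a
transition \<open>z \<mapsto> t z\<close>; hence the same formula in all charts defines a form on the manifold.
\<close>

lemma hermitian_metric_on_hopf_family:
  fixes h :: "((complex ^ 'n::finite) \<times> complex, 'n) form11"
  assumes h: "\<And>c z. c \<in> hopf_atlas \<Longrightarrow> z \<in> chart_image c \<Longrightarrow> h c z = hopf_family a \<kappa> z"
    and pos: "a > 0" "\<kappa> \<ge> 0"
  shows "hermitian_metric_on hopf_atlas h"
proof -
  have U: "open (chart_image c)" "0 \<notin> chart_image c"
    if "c \<in> hopf_atlas" for c :: "((complex ^ 'n) \<times> complex, 'n) chart"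
    using that by (simp_all add: hopf_atlas_def)
  have smooth: "smooth_on (chart_image c) (h c)" if c: "c \<in> hopf_atlas" for c
  proof (rule smooth_on_cong[THEN iffD2])
    show "smooth_on (chart_image c) (hopf_family a \<kappa>)"
      unfolding hopf_family_def[abs_def] using U[OF c] by (intro smooth_intros)
  qed (use U[OF c] h[OF c] in auto)
  have trans: "h c z $ i $ j = (\<Sum>k\<in>UNIV. \<Sum>l\<in>UNIV.
      matrix (frechet_derivative (transition c c') (at z)) $ k $ i *
      cnj (matrix (frechet_derivative (transition c c') (at z)) $ l $ j) * h c' (transition c c' z) $ k $ l)"
    if c: "c \<in> hopf_atlas" and c': "c' \<in> hopf_atlas" and z: "z \<in> snd c ` (fst c \<inter> fst c')" for c c' z i j
  proof -
    obtain t :: real where t: "t > 0" "transition c c' z = t *\<^sub>R z" "t *\<^sub>R z \<in> chart_image c'"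
      and der: "(transition c c' has_derivative (\<lambda>v. t *\<^sub>R v)) (at z)"
      using transition_hopf_atlas[OF c c' z] .
    have Jac: "matrix (frechet_derivative (transition c c') (at z)) $ k $ i = (if k = i then of_real t else 0)" for k i
      unfolding frechet_derivative_at[OF der, symmetric]
      by (simp add: matrix_def axis_def scaleR_conv_of_real[where 'a = complex])
    have "z \<in> chart_image c" using z by (auto simp: chart_image_def)
    moreover have "(if k = i then of_real t else 0) * cnj (if l = j then of_real t else 0) * H $ k $ l =
        (if k = i then if l = j then of_real (t\<^sup>2) * H $ i $ j else 0 else 0)"
      for k l and H :: "complex ^ 'n ^ 'n" by (simp add: power2_eq_square)
    moreover have "(\<Sum>l\<in>UNIV. if k = i then if l = j then x else 0 else 0) = (if k = i then x else 0)"
      for k and x :: complex by simp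
    ultimately show ?thesis
      unfolding Jac t(2) h[OF c' t(3)] using hopf_family_scaleR[of t a \<kappa> z i j] t(1) by (simp only: h[OF c]) simp
  qed
  have herm: "h c z $ j $ i = cnj (h c z $ i $ j)" if "c \<in> hopf_atlas" "z \<in> chart_image c" for c z i j
    using h[OF that] by (simp add: hopf_family_def mult_ac)
  have "0 < Re (\<Sum>i\<in>UNIV. \<Sum>j\<in>UNIV. h c z $ i $ j * v $ i * cnj (v $ j))"
    if c: "c \<in> hopf_atlas" "z \<in> chart_image c" and "v \<noteq> 0" for c z v
  proof -
    have "\<rho> z > 0" using U[OF c(1)] c(2) by (auto simp: \<rho>_def)
    moreover have "(norm v)\<^sup>2 + \<kappa> * \<rho> z * (norm (hprod v z))\<^sup>2 > 0"
      using \<open>v \<noteq> 0\<close> \<open>\<rho> z > 0\<close> pos by (intro add_pos_nonneg) auto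
    moreover have "Re (\<Sum>i\<in>UNIV. \<Sum>j\<in>UNIV. h c z $ i $ j * v $ i * cnj (v $ j)) =
        4 * a * \<rho> z * ((norm v)\<^sup>2 + \<kappa> * \<rho> z * (norm (hprod v z))\<^sup>2)"
      unfolding h[OF c] hopf_family_form hprod_self complex_norm_square[symmetric]
      by (simp only: of_real_mult[symmetric] of_real_add[symmetric] Re_complex_of_real)
    ultimately show ?thesis using pos by simp
  qed
  then show ?thesis
    unfolding hermitian_metric_on_def form11_on_def Let_def
    using smooth trans herm by blast
qed

theorem theorem1p5:
  fixes \<omega>\<^sub>0 \<omega> :: "((complex ^ 'n::finite) \<times> complex, 'n) form11"
  assumes "CARD('n) \<ge> 2"
    and "\<omega>\<^sub>0 = hopf_metric"
    and "\<omega> = (\<lambda>c z. \<omega>\<^sub>0 c z - (4 / real CARD('n)) *\<^sub>R first_lc_ricci_form \<omega>\<^sub>0 c z)"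
  shows "hermitian_metric_on hopf_atlas \<omega> \<and>
    (\<forall>c\<in>hopf_atlas. \<forall>z\<in>chart_image c. first_lc_ricci_form \<omega> c z = 0)"
proof -
  define n where "n = real CARD('n)"
  have n: "n \<ge> 2" using assms(1) by (simp add: n_def)
  \<comment> \<open>Subtracting \<open>4/n\<close> times the Ricci form \<open>\<rho> (1 - P)\<close> from \<open>4 \<rho>\<close> leaves \<open>4 \<rho> (1 - 1/n) (1 + P / (n - 1))\<close>.\<close>
  define a \<kappa> where "a = (n - 1) / n" and "\<kappa> = 1 / (n - 1)"
  have pos: "a > 0" "\<kappa> \<ge> 0" using n by (simp_all add: a_def \<kappa>_def)
  have U: "open (chart_image c)" "0 \<notin> chart_image c"
    if "c \<in> hopf_atlas" for c :: "((complex ^ 'n) \<times> complex, 'n) chart"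
    using that by (simp_all add: hopf_atlas_def)
  have \<omega>\<^sub>0: "\<omega>\<^sub>0 c z = hopf_family 1 0 z" for c z
    by (simp add: assms(2) hopf_metric_def hopf_family_def \<rho>_def vec_eq_iff inverse_eq_divide)
  have \<omega>: "\<omega> c z = hopf_family a \<kappa> z" if c: "c \<in> hopf_atlas" and z: "z \<in> chart_image c" for c z
  proof -
    have "a * \<kappa> = 1 / n" "a = 1 - 1 / n"
      using n by (simp_all add: a_def \<kappa>_def field_simps)
    moreover have "4 * a * \<rho> z * (\<kappa> * \<rho> z) = 4 * (a * \<kappa>) * (\<rho> z)\<^sup>2"
      by (simp add: power2_eq_square)
    ultimately have r: "4 * a * \<rho> z * (\<kappa> * \<rho> z) = 4 / n * (\<rho> z)\<^sup>2" "4 * a * \<rho> z = 4 * \<rho> z - 4 / n * \<rho> z"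
      by (simp, simp add: left_diff_distrib right_diff_distrib)
    have ak: "of_real (4 * a * \<rho> z) = (4 * of_real (\<rho> z) - of_real (4 / n) * of_real (\<rho> z) :: complex)"
      unfolding r(2) by simp
    have ak': "of_real (4 * a * \<rho> z) * of_real (\<kappa> * \<rho> z) = (of_real (4 / n) * of_real ((\<rho> z)\<^sup>2) :: complex)"
      by (simp only: r(1) flip: of_real_mult)
    have "\<omega> c z $ i $ j = of_real (4 * a * \<rho> z) * (if i = j then 1 else 0)
        + (of_real (4 * a * \<rho> z) * of_real (\<kappa> * \<rho> z)) * cnj (z $ i) * z $ j" for i j
      unfolding ak' unfolding ak assms(3)
      by (simp add: first_lc_ricci_form_hopf_family[where a = 1 and \<kappa> = 0, OF U[OF c] \<omega>\<^sub>0 _ _ z]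
          \<omega>\<^sub>0 hopf_family_def n_def[symmetric] scaleR_conv_of_real[where 'a = complex] algebra_simps)
    then show ?thesis by (simp add: vec_eq_iff hopf_family_def algebra_simps)
  qed
  have "1 + \<kappa> - CARD('n) * \<kappa> = 0"
    using n by (simp add: \<kappa>_def n_def[symmetric] field_simps)
  then have "first_lc_ricci_form \<omega> c z = 0" if c: "c \<in> hopf_atlas" and z: "z \<in> chart_image c" for c z
    using first_lc_ricci_form_hopf_family[where h = \<omega>, OF U[OF c] \<omega>[OF c] pos z] by (simp add: vec_eq_iff)
  then show ?thesis
    using hermitian_metric_on_hopf_family[of \<omega>, OF \<omega> pos] by blast
qed

end
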